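(* Let $G$ be a connected, locally path connected topological group with identity element $e_G$. Then there is a one to one correspondence between the equivalence classes of connected covering groups of $G$ and the open subgroups of $\pi_1^{qtop}(G,e_G)$.
   Context: A covering group of a topological group $G$ is a pair $(\widetilde G,p)$ where $\widetilde G$ is a topological group and $p:\widetilde G\to G$ is a group homomorphism such that $(\widetilde G,p)$ is a covering space of $G$. It is connected if $\widetilde G$ is connected. Two covering groups $p:\widetilde G\to G$ and $q:\widetilde H\to G$ are equivalent if there is a group homomorphism $\varphi:\widetilde G\to\widetilde H$ which is a homeomorphism and satisfies $q\circ\varphi=p$. $\pi_1^{qtop}(G,e_G)$ denotes the fundamental group $\pi_1(G,e_G)$ with the quotient topology induced by the natural surjection $\Omega(G,e_G)\to\pi_1(G,e_G)$, where $\Omega(G,e_G)$ is the space of loops in $G$ based at $e_G$ with the compact-open topology. *)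

theory Defs
  imports "HOL-Analysis.Analysis" "HOL-Algebra.Coset"
begin

section \<open>Quotient topology and compact-open topology\<close>

definition quotient_topology :: "'a topology \<Rightarrow> ('a \<Rightarrow> 'b) \<Rightarrow> 'b topology" where
  "quotient_topology X q =
     topology (\<lambda>U. U \<subseteq> q ` topspace X \<and> openin X {x \<in> topspace X. q x \<in> U})"

lemma openin_quotient_topology:
  "openin (quotient_topology X q) U \<longleftrightarrow>
     U \<subseteq> q ` topspace X \<and> openin X {x \<in> topspace X. q x \<in> U}"
proof -
  have "istopology (\<lambda>U. U \<subseteq> q ` topspace X \<and> openin X {x \<in> topspace X. q x \<in> U})"
    unfolding istopology_def
  proof (intro conjI allI impI; (elim conjE)?)
    fix S T assume "openin X {x \<in> topspace X. q x \<in> S}" "openin X {x \<in> topspace X. q x \<in> T}"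
    then have "openin X ({x \<in> topspace X. q x \<in> S} \<inter> {x \<in> topspace X. q x \<in> T})"
      by blast
    then show "openin X {x \<in> topspace X. q x \<in> S \<inter> T}"
      by (rule back_subst) auto
  next
    fix \<K>
    assume K: "\<forall>K\<in>\<K>. K \<subseteq> q ` topspace X \<and> openin X {x \<in> topspace X. q x \<in> K}"
    then have "openin X (\<Union>K\<in>\<K>. {x \<in> topspace X. q x \<in> K})"
      by blast
    then show "openin X {x \<in> topspace X. q x \<in> \<Union>\<K>}"
      by (rule back_subst) auto
  qed auto
  then show ?thesis
    by (simp add: quotient_topology_def topology_inverse')
qed

lemma topspace_quotient_topology: "topspace (quotient_topology X q) = q ` topspace X"
proof
  show "topspace (quotient_topology X q) \<subseteq> q ` topspace X"
    using openin_topspace[of "quotient_topology X q"] unfolding openin_quotient_topology by (rule conjunct1)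
  have "{x \<in> topspace X. q x \<in> q ` topspace X} = topspace X"
    by auto
  then have "openin (quotient_topology X q) (q ` topspace X)"
    by (simp add: openin_quotient_topology)
  then show "q ` topspace X \<subseteq> topspace (quotient_topology X q)"
    by (rule openin_subset)
qed

lemma quotient_map_quotient_topology: "quotient_map X (quotient_topology X q) q"
  unfolding quotient_map_def topspace_quotient_topology openin_quotient_topology by simp

text \<open>
  Continuous maps are taken to be extensional on the domain, so that distinct points of the
  function space are distinct maps.
\<close>

definition compact_open_topology :: "'a topology \<Rightarrow> 'b topology \<Rightarrow> ('a \<Rightarrow> 'b) topology" where
  "compact_open_topology X Y =
     topology_generated_by
       {{f \<in> extensional (topspace X). continuous_map X Y f \<and> f ` K \<subseteq> U} | K U.
          compactin X K \<and> openin Y U}"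


section \<open>The fundamental group and its quotient topology\<close>

abbreviation unit_interval :: "real topology" where
  "unit_interval \<equiv> top_of_set {0..1}"

definition loops :: "'a topology \<Rightarrow> 'a \<Rightarrow> (real \<Rightarrow> 'a) set" where
  "loops X x =
     {\<gamma> \<in> extensional {0..1}. continuous_map unit_interval X \<gamma> \<and> \<gamma> 0 = x \<and> \<gamma> 1 = x}"

definition loop_space :: "'a topology \<Rightarrow> 'a \<Rightarrow> (real \<Rightarrow> 'a) topology" where
  "loop_space X x = subtopology (compact_open_topology unit_interval X) (loops X x)"

definition loop_concat :: "(real \<Rightarrow> 'a) \<Rightarrow> (real \<Rightarrow> 'a) \<Rightarrow> real \<Rightarrow> 'a" where
  "loop_concat \<gamma> \<delta> =
     restrict (\<lambda>t. if t \<le> 1/2 then \<gamma> (2 * t) else \<delta> (2 * t - 1)) {0..1}"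

definition loop_homotopy :: "'a topology \<Rightarrow> 'a \<Rightarrow> ((real \<Rightarrow> 'a) \<times> (real \<Rightarrow> 'a)) set" where
  "loop_homotopy X x =
     {(\<gamma>, \<delta>). \<gamma> \<in> loops X x \<and> \<delta> \<in> loops X x \<and>
        homotopic_with (\<lambda>\<eta>. \<eta> 0 = x \<and> \<eta> 1 = x) unit_interval X \<gamma> \<delta>}"

definition loop_class :: "'a topology \<Rightarrow> 'a \<Rightarrow> (real \<Rightarrow> 'a) \<Rightarrow> (real \<Rightarrow> 'a) set" where
  "loop_class X x \<gamma> = loop_homotopy X x `` {\<gamma>}"

definition fundamental_group :: "'a topology \<Rightarrow> 'a \<Rightarrow> (real \<Rightarrow> 'a) set monoid" where
  "fundamental_group X x =
     \<lparr>carrier = loops X x // loop_homotopy X x,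
      monoid.mult = (\<lambda>A B. \<Union>\<gamma>\<in>A. \<Union>\<delta>\<in>B. loop_class X x (loop_concat \<gamma> \<delta>)),
      one = loop_class X x (restrict (\<lambda>_. x) {0..1})\<rparr>"

definition fundamental_group_qtop :: "'a topology \<Rightarrow> 'a \<Rightarrow> (real \<Rightarrow> 'a) set topology" where
  "fundamental_group_qtop X x = quotient_topology (loop_space X x) (loop_class X x)"

definition open_subgroups_pi1 :: "'a topology \<Rightarrow> 'a \<Rightarrow> (real \<Rightarrow> 'a) set set set" where
  "open_subgroups_pi1 X x =
     {H. subgroup H (fundamental_group X x) \<and> openin (fundamental_group_qtop X x) H}"

text \<open>The homomorphism on fundamental groups induced by a map to \<open>(Y, y)\<close>.\<close>

definition pi1_map ::
    "'b topology \<Rightarrow> 'b \<Rightarrow> ('a \<Rightarrow> 'b) \<Rightarrow> (real \<Rightarrow> 'a) set \<Rightarrow> (real \<Rightarrow> 'b) set" where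
  "pi1_map Y y f A = (\<Union>\<gamma>\<in>A. loop_class Y y (restrict (f \<circ> \<gamma>) {0..1}))"


section \<open>Covering groups\<close>

text \<open>No separation axiom is assumed.\<close>

definition topological_group :: "'a monoid \<Rightarrow> 'a topology \<Rightarrow> bool" where
  "topological_group G X \<longleftrightarrow>
     group G \<and> topspace X = carrier G \<and>
     continuous_map (prod_topology X X) X (\<lambda>(x, y). x \<otimes>\<^bsub>G\<^esub> y) \<and>
     continuous_map X X (\<lambda>x. inv\<^bsub>G\<^esub> x)"

text \<open>The analogue for abstract topologies of the library's \<^const>\<open>covering_space\<close>.\<close>

definition covering_map :: "'a topology \<Rightarrow> 'b topology \<Rightarrow> ('a \<Rightarrow> 'b) \<Rightarrow> bool" where
  "covering_map X Y p \<longleftrightarrow>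
     continuous_map X Y p \<and> p ` topspace X = topspace Y \<and>
     (\<forall>y \<in> topspace Y. \<exists>U. y \<in> U \<and> openin Y U \<and>
        (\<exists>\<V>. \<Union>\<V> = {x \<in> topspace X. p x \<in> U} \<and>
             (\<forall>V\<in>\<V>. openin X V) \<and>
             pairwise disjnt \<V> \<and>
             (\<forall>V\<in>\<V>. homeomorphic_map (subtopology X V) (subtopology Y U) p)))"

text \<open>
  A group over a base group \<open>(G, X)\<close> is a triple consisting of a group, a topology on it,
  and a projection, whose values outside the carrier are irrelevant.
\<close>

type_synonym ('h, 'a) group_over = "'h monoid \<times> 'h topology \<times> ('h \<Rightarrow> 'a)"

definition connected_covering_group ::
    "'a monoid \<Rightarrow> 'a topology \<Rightarrow> ('h, 'a) group_over \<Rightarrow> bool" where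
  "connected_covering_group G X = (\<lambda>(K, Y, p).
     topological_group K Y \<and> p \<in> hom K G \<and> covering_map Y X p \<and> connected_space Y)"

definition covering_group_equivalent ::
    "('h, 'a) group_over \<Rightarrow> ('k, 'a) group_over \<Rightarrow> bool" where
  "covering_group_equivalent = (\<lambda>(K, Y, p) (L, Z, q).
     \<exists>\<phi>. \<phi> \<in> hom K L \<and> homeomorphic_map Y Z \<phi> \<and> (\<forall>x \<in> carrier K. q (\<phi> x) = p x))"

definition connected_covering_groups ::
    "'a monoid \<Rightarrow> 'a topology \<Rightarrow> ('h, 'a) group_over set" where
  "connected_covering_groups G X = {C. connected_covering_group G X C}"

definition covering_group_equiv_rel ::
    "'a monoid \<Rightarrow> 'a topology \<Rightarrow> (('h, 'a) group_over \<times> ('h, 'a) group_over) set" where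
  "covering_group_equiv_rel G X =
     {(C, D). C \<in> connected_covering_groups G X \<and> D \<in> connected_covering_groups G X \<and>
        covering_group_equivalent C D}"

text \<open>The image of the fundamental group of a covering group under the projection.\<close>

definition covering_group_pi1_image ::
    "'a monoid \<Rightarrow> 'a topology \<Rightarrow> ('h, 'a) group_over \<Rightarrow> (real \<Rightarrow> 'a) set set" where
  "covering_group_pi1_image G X = (\<lambda>(K, Y, p).
     pi1_map X \<one>\<^bsub>G\<^esub> p ` carrier (fundamental_group Y \<one>\<^bsub>K\<^esub>))"

text \<open>
  The connected covering groups of \<open>G\<close> over all types do not form a set in HOL. Equivalence
  classes are therefore formed among covering groups whose elements are of type
  \<open>(real \<Rightarrow> 'a) set\<close>, that is, sets of paths in \<open>G\<close>. That this loses nothing, i.e. that every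
  connected covering group over an arbitrary type \<open>'h\<close> is equivalent to one of these, is stated
  as part of the theorem.
\<close>

type_synonym 'a path_group_over = "((real \<Rightarrow> 'a) set, 'a) group_over"

end

theory Submission
  imports Defs
begin

text \<open>
  Multiplying paths pointwise turns the paths in \<open>G\<close> that start at \<open>\<one>\<close> into a group \<open>P\<close>, in
  which the loops at \<open>\<one>\<close> form a normal subgroup \<open>L\<close>, the kernel of the endpoint map \<open>P \<rightarrow> G\<close>.
  This group replaces concatenation of paths throughout. Reparametrising the two factors shows
  that a pointwise product of loops is homotopic to their concatenation (\<open>cls_loop_concat\<close>), so
  the fundamental group is the quotient of \<open>L\<close> by the null-homotopic loops. Its subgroups
  \<open>H\<close> correspond to the homotopy-closed subgroups \<open>N\<close> of \<open>L\<close>, where \<open>N\<close> consists of the loops with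
  class in \<open>H\<close>, and each such \<open>N\<close> is normal in \<open>P\<close>, since a path \<open>\<alpha>\<close> can be
  contracted inside \<open>\<alpha> \<gamma> \<alpha>\<^sup>-\<^sup>1\<close> (\<open>normal_loops_of\<close>).

  Openness of \<open>H\<close> has an elementary meaning: it holds exactly when \<open>N\<close> contains all loops that
  stay in some neighbourhood \<open>U\<close> of \<open>\<one>\<close> (\<open>small_loops_in_open\<close>, \<open>open_subgroup_of_loops\<close>).

  For such an \<open>N\<close>, the quotient \<open>P / N\<close> with projection \<open>N \<alpha> \<mapsto> \<alpha> 1\<close> is a connected covering
  group of \<open>G\<close>, where a neighbourhood of \<open>N \<alpha>\<close> consists of the cosets \<open>N (\<beta> \<alpha>)\<close> for paths \<open>\<beta>\<close>
  in a neighbourhood of \<open>\<one>\<close>. It is evenly covered because two paths in a small set with the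
  same endpoint differ by a small loop, hence by an element of \<open>N\<close>.

  Conversely, let \<open>p : K \<rightarrow> G\<close> be a connected covering group. Composition with \<open>p\<close> is an
  isomorphism from the path group of \<open>K\<close> to that of \<open>G\<close>: this is unique path lifting, and here
  it follows from one principle (\<open>deform_into_subgroup\<close>), that a subgroup of paths which
  contains all small paths is closed under deformation. If \<open>N\<close> is the group of loops in \<open>G\<close> whose
  lift is closed, the same principle shows that \<open>N\<close> is closed under homotopy, and the endpoint of the
  lift induces an isomorphism of covering groups \<open>P / N \<cong> K\<close> (\<open>equivalent_model\<close>). So a
  connected covering group is determined up to equivalence by \<open>N\<close>, or equivalently by the
  image of its fundamental group, and every one of them has a model made of sets of paths in \<open>G\<close>.
\<close>

section \<open>Topological groups\<close>

locale top_group = group G for G :: "'a monoid" (structure) +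
  fixes X :: "'a topology"
  assumes topspace_eq [simp]: "topspace X = carrier G"
    and continuous_mult: "continuous_map (prod_topology X X) X (\<lambda>(x, y). x \<otimes> y)"
    and continuous_inv: "continuous_map X X (\<lambda>x. inv x)"
begin

lemma cm_carrier: "continuous_map Z X f \<Longrightarrow> z \<in> topspace Z \<Longrightarrow> f z \<in> carrier G"
  using continuous_map_image_subset_topspace by fastforce

lemma cm_mult:
  assumes "continuous_map Z X f" "continuous_map Z X g"
  shows "continuous_map Z X (\<lambda>z. f z \<otimes> g z)"
proof -
  have "continuous_map Z (prod_topology X X) (\<lambda>z. (f z, g z))"
    using assms by (simp add: continuous_map_paired)
  from continuous_map_compose[OF this continuous_mult] show ?thesis
    by (simp add: o_def)
qed

lemma cm_inv: "continuous_map Z X f \<Longrightarrow> continuous_map Z X (\<lambda>z. inv (f z))"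
  using continuous_map_compose[OF _ continuous_inv] by (simp add: o_def)

lemma cm_const: "g \<in> carrier G \<Longrightarrow> continuous_map Z X (\<lambda>z. g)"
  by simp

lemma open_mult_vimage:
  assumes "openin X U" "g \<in> carrier G"
  shows "openin X {x \<in> carrier G. x \<otimes> g \<in> U}"
  using openin_continuous_map_preimage[OF cm_mult[OF continuous_map_id cm_const[OF assms(2)]] assms(1)]
  by simp

lemma open_conj_vimage:
  assumes "openin X U" "g \<in> carrier G"
  shows "openin X {x \<in> carrier G. g \<otimes> x \<otimes> inv g \<in> U}"
  using openin_continuous_map_preimage[OF cm_mult[OF cm_mult[OF cm_const[OF assms(2)]
      continuous_map_id] cm_const] assms(1)] assms(2)
  by simp

lemma open_inv_vimage: "openin X U \<Longrightarrow> openin X {x \<in> carrier G. inv x \<in> U}"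
  using openin_continuous_map_preimage[OF continuous_inv] by simp

lemma one_nbhd_mult:
  assumes "openin X U" "\<one> \<in> U"
  obtains V where "openin X V" "\<one> \<in> V" "\<And>x y. x \<in> V \<Longrightarrow> y \<in> V \<Longrightarrow> x \<otimes> y \<in> U"
proof -
  have "openin (prod_topology X X) {z \<in> topspace (prod_topology X X). (case z of (x,y) \<Rightarrow> x \<otimes> y) \<in> U}"
    by (rule openin_continuous_map_preimage[OF continuous_mult assms(1)])
  moreover have "(\<one>,\<one>) \<in> {z \<in> topspace (prod_topology X X). (case z of (x,y) \<Rightarrow> x \<otimes> y) \<in> U}"
    using assms(2) by simp
  ultimately obtain A B where AB: "openin X A" "openin X B" "\<one> \<in> A" "\<one> \<in> B"
      "A \<times> B \<subseteq> {z \<in> topspace (prod_topology X X). (case z of (x,y) \<Rightarrow> x \<otimes> y) \<in> U}"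
    unfolding openin_prod_topology_alt by meson
  show ?thesis
    by (rule that[of "A \<inter> B"]) (use AB in auto)
qed

lemma one_nbhd_inv_mult:
  assumes "openin X U" "\<one> \<in> U"
  obtains V where "openin X V" "\<one> \<in> V" "\<forall>x\<in>V. inv x \<in> V" "\<forall>x\<in>V. \<forall>y\<in>V. x \<otimes> y \<in> U"
proof -
  obtain V where V: "openin X V" "\<one> \<in> V" "\<And>x y. x \<in> V \<Longrightarrow> y \<in> V \<Longrightarrow> x \<otimes> y \<in> U"
    using one_nbhd_mult[OF assms] by blast
  have sub: "V \<subseteq> carrier G" using openin_subset[OF V(1)] by simp
  let ?W = "V \<inter> {x \<in> carrier G. inv x \<in> V}"
  have "openin X ?W" by (intro openin_Int V(1) open_inv_vimage)
  then show ?thesis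
    using V(2,3) sub by (intro that[of ?W]) auto
qed

text \<open>
  A union of cosets of a subgroup containing a neighbourhood of \<open>\<one>\<close> is open, so the subgroup is both
  open and closed.
\<close>

lemma open_subgroup_eq_carrier:
  assumes conn: "connected_space X" and M: "subgroup M G"
    and U: "openin X U" "\<one> \<in> U" "U \<subseteq> M"
  shows "M = carrier G"
proof -
  interpret M: subgroup M G by fact
  have sub: "U \<subseteq> carrier G" using openin_subset[OF U(1)] by simp
  have "openin X S" if S: "S \<subseteq> carrier G" "\<And>m x. m \<in> M \<Longrightarrow> x \<in> S \<Longrightarrow> m \<otimes> x \<in> S" for S
  proof (subst openin_subopen, intro ballI)
    fix x assume x: "x \<in> S"
    with S have xG: "x \<in> carrier G" by auto
    have "y \<in> S" if "y \<in> carrier G" "y \<otimes> inv x \<in> U" for y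
      using S(2)[of "y \<otimes> inv x" x] that U(3) x xG by (auto simp: m_assoc)
    then show "\<exists>T. openin X T \<and> x \<in> T \<and> T \<subseteq> S"
      using xG U(2) open_mult_vimage[OF U(1), of "inv x"]
      by (intro exI[of _ "{y \<in> carrier G. y \<otimes> inv x \<in> U}"]) auto
  qed
  note * = this
  have "openin X M" by (rule *) auto
  moreover have "openin X (carrier G - M)"
  proof (rule *)
    fix m x assume m: "m \<in> M" "x \<in> carrier G - M"
    have "m \<otimes> x \<notin> M"
    proof
      assume "m \<otimes> x \<in> M"
      then have "inv m \<otimes> (m \<otimes> x) \<in> M" using m by (simp add: M.m_inv_closed)
      then show False using m by (simp add: m_assoc[symmetric])
    qed
    then show "m \<otimes> x \<in> carrier G - M" using m by simp
  qed auto
  ultimately have "openin X M" "closedin X M"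
    by (auto simp: closedin_def)
  then have "M = {} \<or> M = topspace X"
    using conn unfolding connected_space_clopen_in by blast
  then show ?thesis using M.one_closed by (simp only: topspace_eq) blast
qed

end

lemma top_group_iff: "topological_group G X \<longleftrightarrow> top_group G X"
  by (auto simp: topological_group_def top_group_def top_group_axioms_def)

section \<open>Maps on the unit interval\<close>

lemma connected_unit_interval: "connected_space unit_interval"
  using connected_Icc[of 0 "1::real"] by (metis connectedin_def connectedin_iff_connected)

text \<open>
  Connectedness of the interval in the form in which it is used for path lifting: a property that
  can be propagated both ways between nearby parameters holds everywhere.
\<close>

lemma locally_constant_unit_interval:
  assumes "\<And>s. s \<in> {0..1} \<Longrightarrow> \<exists>V. openin unit_interval V \<and> s \<in> V \<and> (\<forall>s'\<in>V. R s' \<longleftrightarrow> R s)"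
    and "R 0" "s \<in> {0..1}"
  shows "R s"
proof -
  have nbhd: "openin unit_interval {s \<in> {0..1}. R s = b}" for b
  proof (rule openin_subopen[THEN iffD2], rule ballI)
    fix s assume s: "s \<in> {s \<in> {0..1}. R s = b}"
    then obtain V where V: "openin unit_interval V" "s \<in> V" "\<forall>s'\<in>V. R s' \<longleftrightarrow> R s"
      using assms(1)[of s] by blast
    moreover have "V \<subseteq> {0..1}" using openin_subset[OF V(1)] by simp
    ultimately show "\<exists>V. openin unit_interval V \<and> s \<in> V \<and> V \<subseteq> {s \<in> {0..1}. R s = b}"
      using s by blast
  qed
  have "{s \<in> {0..1}. R s = False} = topspace unit_interval - {s \<in> {0..1}. R s = True}" by auto
  then have "closedin unit_interval {s \<in> {0..1}. R s = True}"
    using nbhd[of False] unfolding closedin_def by (simp_all only: topspace_euclidean_subtopology) blast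
  then have "{s \<in> {0..1}. R s = True} = {} \<or> {s \<in> {0..1}. R s = True} = topspace unit_interval"
    using nbhd[of True] connected_unit_interval unfolding connected_space_clopen_in by blast
  moreover have "0 \<in> {s \<in> {0..1}. R s = True}" using assms(2) by simp
  ultimately have "{s \<in> {0..1}. R s = True} = {0..1}" by auto
  then show ?thesis using assms(3) by blast
qed

lemma continuous_map_to_unit_interval:
  assumes "continuous_map Z euclideanreal r" "\<And>z. z \<in> topspace Z \<Longrightarrow> r z \<in> {0..1}"
  shows "continuous_map Z unit_interval r"
  using assms by (auto simp: continuous_map_in_subtopology)

lemma continuous_map_unit_interval_restrict:
  assumes "continuous_map unit_interval X f"
  shows "continuous_map unit_interval X (restrict f {0..1})"
  by (rule continuous_map_eq[OF assms]) auto

lemma real_fst_snd_continuous: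
  "continuous_map (prod_topology unit_interval unit_interval) euclideanreal fst"
  "continuous_map (prod_topology unit_interval unit_interval) euclideanreal snd"
  by (meson continuous_map_fst continuous_map_snd continuous_map_into_fulltopology)+

lemma continuous_map_slice:
  assumes "continuous_map (prod_topology unit_interval unit_interval) X h" "s \<in> {0..1}"
  shows "continuous_map unit_interval X (\<lambda>t. h (s, t))"
proof -
  have "continuous_map unit_interval (prod_topology unit_interval unit_interval) (\<lambda>t::real. (s, t))"
    using assms(2) by (intro continuous_map_pairedI continuous_map_id[unfolded id_def]) auto
  from continuous_map_compose[OF this assms(1)] show ?thesis by (simp add: o_def)
qed

text \<open>
  The tube lemma: projecting along the compact interval is a closed map, so the parameters whose
  slice leaves the open set form a closed set.
\<close>

lemma open_tube:
  assumes F: "continuous_map (prod_topology T unit_interval) X F" and U: "openin X U"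
  shows "openin T {s \<in> topspace T. \<forall>t\<in>{0..1}. F (s, t) \<in> U}"
proof -
  let ?C = "{z \<in> topspace (prod_topology T unit_interval). F z \<in> topspace X - U}"
  have cl: "closedin (prod_topology T unit_interval) ?C"
    by (rule closedin_continuous_map_preimage[OF F]) (use U in blast)
  have "compact_space unit_interval"
    by (simp add: compact_space_subtopology compactin_euclidean_iff)
  then have "closedin T (fst ` ?C)"
    using Abstract_Topological_Spaces.closed_map_fst cl unfolding closed_map_def by blast
  then have "openin T (topspace T - fst ` ?C)" by blast
  moreover have "F z \<in> topspace X" if "z \<in> topspace T \<times> {0..1}" for z
    using continuous_map_image_subset_topspace[OF F] that by auto
  then have "topspace T - fst ` ?C = {s \<in> topspace T. \<forall>t\<in>{0..1}. F (s, t) \<in> U}"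
    by (force simp: image_iff)
  ultimately show ?thesis by simp
qed

section \<open>The group of paths\<close>

definition paths_from :: "'a topology \<Rightarrow> 'a \<Rightarrow> (real \<Rightarrow> 'a) set" where
  "paths_from X x = {\<alpha> \<in> extensional {0..1}. continuous_map unit_interval X \<alpha> \<and> \<alpha> 0 = x}"

definition path_group :: "'a monoid \<Rightarrow> 'a topology \<Rightarrow> (real \<Rightarrow> 'a) monoid" where
  "path_group G X =
     \<lparr>carrier = paths_from X \<one>\<^bsub>G\<^esub>,
      monoid.mult = (\<lambda>\<alpha> \<beta>. restrict (\<lambda>t. \<alpha> t \<otimes>\<^bsub>G\<^esub> \<beta> t) {0..1}),
      one = restrict (\<lambda>_. \<one>\<^bsub>G\<^esub>) {0..1}\<rparr>"

lemma loops_iff: "\<gamma> \<in> loops X x \<longleftrightarrow> \<gamma> \<in> paths_from X x \<and> \<gamma> 1 = x"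
  by (auto simp: loops_def paths_from_def)

lemma paths_from_compose:
  assumes "\<alpha> \<in> paths_from X x" "continuous_map Z unit_interval r"
  shows "continuous_map Z X (\<lambda>z. \<alpha> (r z))"
  using continuous_map_compose[OF assms(2), of X \<alpha>] assms(1) by (simp add: paths_from_def o_def)

lemma paths_from_restrictI:
  assumes "continuous_map unit_interval X f" "f 0 = x"
  shows "restrict f {0..1} \<in> paths_from X x"
  using assms by (simp add: paths_from_def continuous_map_unit_interval_restrict)

lemma paths_from_eqI:
  assumes "\<alpha> \<in> paths_from X x" "\<beta> \<in> paths_from X y" "\<And>t. t \<in> {0..1} \<Longrightarrow> \<alpha> t = \<beta> t"
  shows "\<alpha> = \<beta>"
  using assms by (auto simp: paths_from_def intro: extensionalityI)

context top_group
begin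

abbreviation P where "P \<equiv> path_group G X"

lemma path_group_simps:
  "carrier P = paths_from X \<one>"
  "\<alpha> \<otimes>\<^bsub>P\<^esub> \<beta> = restrict (\<lambda>t. \<alpha> t \<otimes> \<beta> t) {0..1}"
  "\<one>\<^bsub>P\<^esub> = restrict (\<lambda>_. \<one>) {0..1}"
  by (simp_all add: path_group_def)

lemma path_in_carrier: "\<alpha> \<in> carrier P \<Longrightarrow> t \<in> {0..1} \<Longrightarrow> \<alpha> t \<in> carrier G"
  using cm_carrier[of unit_interval \<alpha>] by (simp add: path_group_simps paths_from_def)

lemma path_at_0: "\<alpha> \<in> carrier P \<Longrightarrow> \<alpha> 0 = \<one>"
  by (simp add: path_group_simps paths_from_def)

lemma path_continuous: "\<alpha> \<in> carrier P \<Longrightarrow> continuous_map unit_interval X \<alpha>"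
  by (simp add: path_group_simps paths_from_def)

lemma path_eqI:
  "\<alpha> \<in> carrier P \<Longrightarrow> \<beta> \<in> carrier P \<Longrightarrow> (\<And>t. t \<in> {0..1} \<Longrightarrow> \<alpha> t = \<beta> t) \<Longrightarrow> \<alpha> = \<beta>"
  unfolding path_group_simps by (rule paths_from_eqI)

lemma restrict_in_path_group:
  "continuous_map unit_interval X f \<Longrightarrow> f 0 = \<one> \<Longrightarrow> restrict f {0..1} \<in> carrier P"
  unfolding path_group_simps by (rule paths_from_restrictI)

lemma path_mult_closed: "\<alpha> \<in> carrier P \<Longrightarrow> \<beta> \<in> carrier P \<Longrightarrow> \<alpha> \<otimes>\<^bsub>P\<^esub> \<beta> \<in> carrier P"
  unfolding path_group_simps(2)
  by (rule restrict_in_path_group) (simp_all add: path_at_0 path_continuous cm_mult)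

lemma path_one_closed: "\<one>\<^bsub>P\<^esub> \<in> carrier P"
  unfolding path_group_simps(3) by (rule restrict_in_path_group) simp_all

lemma path_inv_closed: "\<alpha> \<in> carrier P \<Longrightarrow> restrict (\<lambda>t. inv (\<alpha> t)) {0..1} \<in> carrier P"
  by (rule restrict_in_path_group) (simp_all add: path_at_0 path_continuous cm_inv)

lemma path_mult_at: "t \<in> {0..1} \<Longrightarrow> (\<alpha> \<otimes>\<^bsub>P\<^esub> \<beta>) t = \<alpha> t \<otimes> \<beta> t"
  by (simp add: path_group_simps)

lemma path_one_at: "t \<in> {0..1} \<Longrightarrow> \<one>\<^bsub>P\<^esub> t = \<one>"
  by (simp add: path_group_simps)

lemma group_path_group: "group P"
proof (rule groupI)
  fix \<alpha> \<beta> \<gamma> assume "\<alpha> \<in> carrier P" "\<beta> \<in> carrier P" "\<gamma> \<in> carrier P"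
  then show "(\<alpha> \<otimes>\<^bsub>P\<^esub> \<beta>) \<otimes>\<^bsub>P\<^esub> \<gamma> = \<alpha> \<otimes>\<^bsub>P\<^esub> (\<beta> \<otimes>\<^bsub>P\<^esub> \<gamma>)"
    by (intro path_eqI path_mult_closed) (simp_all add: path_mult_at path_in_carrier m_assoc)
next
  fix \<alpha> assume "\<alpha> \<in> carrier P"
  then show "\<one>\<^bsub>P\<^esub> \<otimes>\<^bsub>P\<^esub> \<alpha> = \<alpha>"
    by (intro path_eqI path_mult_closed path_one_closed)
       (simp_all add: path_mult_at path_one_at path_in_carrier)
next
  fix \<alpha> assume \<alpha>: "\<alpha> \<in> carrier P"
  show "\<exists>\<beta>\<in>carrier P. \<beta> \<otimes>\<^bsub>P\<^esub> \<alpha> = \<one>\<^bsub>P\<^esub>"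
    by (intro bexI[OF _ path_inv_closed[OF \<alpha>]] path_eqI path_mult_closed path_inv_closed path_one_closed \<alpha>)
       (simp add: path_mult_at path_one_at path_in_carrier[OF \<alpha>])
qed (simp_all add: path_mult_closed path_one_closed)

sublocale P: group P
  by (rule group_path_group)

lemma path_inv_eq: "\<alpha> \<in> carrier P \<Longrightarrow> inv\<^bsub>P\<^esub> \<alpha> = restrict (\<lambda>t. inv (\<alpha> t)) {0..1}"
  by (intro P.inv_equality path_eqI path_mult_closed path_one_closed path_inv_closed)
     (simp_all add: path_mult_at path_one_at path_in_carrier)

lemma path_inv_at: "\<alpha> \<in> carrier P \<Longrightarrow> t \<in> {0..1} \<Longrightarrow> (inv\<^bsub>P\<^esub> \<alpha>) t = inv (\<alpha> t)"
  by (simp add: path_inv_eq)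

lemmas path_at = path_mult_at path_one_at path_inv_at

abbreviation L where "L \<equiv> loops X \<one>"

lemma loops_iff_end: "\<gamma> \<in> L \<longleftrightarrow> \<gamma> \<in> carrier P \<and> \<gamma> 1 = \<one>"
  by (simp add: loops_iff path_group_simps)

lemma loops_subset: "L \<subseteq> carrier P"
  by (auto simp: loops_iff_end)

lemma subgroup_loops: "subgroup L P"
proof (rule P.subgroupI)
  have "\<one>\<^bsub>P\<^esub> \<in> L" by (simp add: loops_iff_end path_at path_one_closed)
  then show "L \<noteq> {}" by blast
qed (simp_all add: loops_iff_end path_at loops_subset)

sublocale L: subgroup L P
  by (rule subgroup_loops)

definition endpoint :: "(real \<Rightarrow> 'a) \<Rightarrow> 'a" where "endpoint \<alpha> = \<alpha> 1"

lemma endpoint_hom: "endpoint \<in> hom P G"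
  by (auto simp: hom_def endpoint_def path_at path_in_carrier)

definition small :: "'a set \<Rightarrow> (real \<Rightarrow> 'a) set" where
  "small U = {\<alpha> \<in> carrier P. \<forall>t\<in>{0..1}. \<alpha> t \<in> U}"

lemma small_mono: "U \<subseteq> V \<Longrightarrow> small U \<subseteq> small V"
  by (auto simp: small_def)

text \<open>
  A map on the square is read as a path of paths; \<open>slice h s\<close> is the path at parameter \<open>s\<close>.
\<close>

definition slice :: "(real \<times> real \<Rightarrow> 'a) \<Rightarrow> real \<Rightarrow> real \<Rightarrow> 'a" where
  "slice h s = restrict (\<lambda>t. h (s, t)) {0..1}"

lemma slice_in_path_group:
  assumes "continuous_map (prod_topology unit_interval unit_interval) X h" "s \<in> {0..1}" "h (s, 0) = \<one>"
  shows "slice h s \<in> carrier P"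
  unfolding slice_def by (rule restrict_in_path_group[OF continuous_map_slice[OF assms(1,2)] assms(3)])

text \<open>
  Uniform closeness of slices. The parameter space is arbitrary because the lemma is applied to the
  interval and also to the loop space with the evaluation map.
\<close>

lemma nearby_slices:
  assumes h: "continuous_map (prod_topology T unit_interval) X h"
    and U: "openin X U" "\<one> \<in> U" and s0: "s0 \<in> topspace T"
  shows "\<exists>V. openin T V \<and> s0 \<in> V \<and> (\<forall>s\<in>V. \<forall>t\<in>{0..1}. h (s, t) \<otimes> inv h (s0, t) \<in> U)"
proof -
  let ?F = "\<lambda>z. h z \<otimes> inv h (s0, snd z)"
  have h0: "continuous_map (prod_topology T unit_interval) X (\<lambda>z. h (s0, snd z))"
  proof -
    have "continuous_map (prod_topology T unit_interval) (prod_topology T unit_interval) (\<lambda>z. (s0, snd z))"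
      using s0 by (simp add: continuous_map_paired continuous_map_snd)
    from continuous_map_compose[OF this h] show ?thesis by (simp add: o_def)
  qed
  then have "continuous_map (prod_topology T unit_interval) X ?F"
    by (intro cm_mult cm_inv h)
  from open_tube[OF this U(1)]
  have "openin T {s \<in> topspace T. \<forall>t\<in>{0..1}. h (s, t) \<otimes> inv h (s0, t) \<in> U}" by simp
  moreover have "h (s0, t) \<in> carrier G" if "t \<in> {0..1}" for t
    using cm_carrier[OF h, of "(s0,t)"] s0 that by simp
  ultimately show ?thesis
    using s0 U(2) by (intro exI[of _ "{s \<in> topspace T. \<forall>t\<in>{0..1}. h (s, t) \<otimes> inv h (s0, t) \<in> U}"]) auto
qed

text \<open>
  Slices at nearby parameters differ by a small element of \<open>S\<close>, hence by an element of \<open>M\<close>, so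
  membership of the slices in \<open>M\<close> is locally constant. With \<open>S\<close> the group of all paths this yields path lifting;
  with \<open>S\<close> the group of loops it yields invariance under homotopies of loops.
\<close>

lemma deform_into_subgroup:
  assumes M: "subgroup M P" and S: "subgroup S P"
    and U: "openin X U" "\<one> \<in> U" "S \<inter> small U \<subseteq> M"
    and h: "continuous_map (prod_topology unit_interval unit_interval) X h"
    and hS: "\<And>s. s \<in> {0..1} \<Longrightarrow> slice h s \<in> S"
    and h0: "slice h 0 \<in> M"
  shows "slice h 1 \<in> M"
proof -
  interpret M: subgroup M P by fact
  interpret S: subgroup S P by fact
  have near: "\<exists>V. openin unit_interval V \<and> s0 \<in> V \<and> (\<forall>s\<in>V. slice h s \<in> M \<longleftrightarrow> slice h s0 \<in> M)"
    if s0: "s0 \<in> {0..1}" for s0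
  proof -
    obtain V where V: "openin unit_interval V" "s0 \<in> V"
        "\<And>s t. s \<in> V \<Longrightarrow> t \<in> {0..1} \<Longrightarrow> h (s, t) \<otimes> inv h (s0, t) \<in> U"
      using nearby_slices[OF h U(1,2), of s0] s0 by auto
    have "slice h s \<in> M \<longleftrightarrow> slice h s0 \<in> M" if s: "s \<in> V" for s
    proof -
      have sI: "s \<in> {0..1}" using openin_subset[OF V(1)] s by auto
      let ?d = "slice h s \<otimes>\<^bsub>P\<^esub> inv\<^bsub>P\<^esub> slice h s0"
      have P: "slice h s \<in> carrier P" "slice h s0 \<in> carrier P"
        using hS s0 sI by auto
      have "?d \<in> S" using hS s0 sI by simp
      moreover have "?d \<in> small U"
        unfolding small_def using P V(3)[OF s] by (auto simp: path_at) (auto simp: slice_def)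
      ultimately have d: "?d \<in> M" using U(3) by blast
      have e1: "slice h s = ?d \<otimes>\<^bsub>P\<^esub> slice h s0"
        using P by (simp add: P.m_assoc)
      have e2: "slice h s0 = inv\<^bsub>P\<^esub> ?d \<otimes>\<^bsub>P\<^esub> slice h s"
        using P by (simp add: P.inv_mult_group P.m_assoc)
      show ?thesis
        using d e1 e2 M.m_closed M.m_inv_closed by metis
    qed
    then show ?thesis using V(1,2) by blast
  qed
  show ?thesis
    by (rule locally_constant_unit_interval[where R = "\<lambda>s. slice h s \<in> M", OF near h0]) simp_all
qed

lemma slice_eqI:
  "\<gamma> \<in> extensional {0..1} \<Longrightarrow> (\<And>t. t \<in> {0..1} \<Longrightarrow> h (s, t) = \<gamma> t) \<Longrightarrow> slice h s = \<gamma>"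
  unfolding slice_def by (rule extensionalityI[of _ "{0..1}"]) auto

definition stretch :: "(real \<Rightarrow> 'a) \<Rightarrow> real \<times> real \<Rightarrow> 'a" where
  "stretch \<alpha> = (\<lambda>(s, t). \<alpha> (s * t))"

lemma stretch:
  assumes \<alpha>: "\<alpha> \<in> carrier P"
  shows "continuous_map (prod_topology unit_interval unit_interval) X (stretch \<alpha>)"
    and "stretch \<alpha> (s, 0) = \<one>" and "slice (stretch \<alpha>) 0 = \<one>\<^bsub>P\<^esub>" and "slice (stretch \<alpha>) 1 = \<alpha>"
    and "slice (stretch \<alpha>) s 1 = \<alpha> s"
proof -
  have r: "continuous_map (prod_topology unit_interval unit_interval) unit_interval (\<lambda>z. fst z * snd z)"
    by (rule continuous_map_to_unit_interval)
       (auto intro!: continuous_intros real_fst_snd_continuous simp: mult_le_one)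
  show "continuous_map (prod_topology unit_interval unit_interval) X (stretch \<alpha>)"
    using \<alpha> unfolding path_group_simps stretch_def case_prod_unfold by (rule paths_from_compose[OF _ r])
  show "stretch \<alpha> (s, 0) = \<one>" by (simp add: stretch_def path_at_0[OF \<alpha>])
  show "slice (stretch \<alpha>) 0 = \<one>\<^bsub>P\<^esub>" by (simp add: stretch_def slice_def path_at_0[OF \<alpha>] path_group_simps)
  show "slice (stretch \<alpha>) 1 = \<alpha>"
    by (rule slice_eqI) (use \<alpha> in \<open>simp_all add: stretch_def path_group_simps paths_from_def\<close>)
  show "slice (stretch \<alpha>) s 1 = \<alpha> s" by (simp add: slice_def stretch_def)
qed

text \<open>
  Local path connectedness in the language of the path group. The paths stay in the neighbourhood
  itself, so its points are endpoints of paths that are as small as desired.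
\<close>

lemma small_path_nbhd:
  assumes lpc: "locally_path_connected_space X" and U: "openin X U" "\<one> \<in> U"
  obtains W where "openin X W" "\<one> \<in> W" "W \<subseteq> U" "\<forall>w\<in>W. \<exists>\<beta>\<in>small W. \<beta> 1 = w"
proof -
  obtain W where W: "openin X W" "path_connectedin X W" "\<one> \<in> W" "W \<subseteq> U"
    using lpc U unfolding locally_path_connected_space by blast
  have "\<exists>\<beta>\<in>small W. \<beta> 1 = w" if w: "w \<in> W" for w
  proof -
    obtain g where g: "pathin X g" "g \<in> {0..1} \<rightarrow> W" "g 0 = \<one>" "g 1 = w"
      using W(2,3) w unfolding path_connectedin by blast
    have "restrict g {0..1} \<in> carrier P"
      by (rule restrict_in_path_group) (use g in \<open>simp_all add: pathin_def\<close>)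
    then show ?thesis
      using g by (intro bexI[of _ "restrict g {0..1}"]) (auto simp: small_def)
  qed
  with W show ?thesis using that by blast
qed

text \<open>
  The points that can be joined to \<open>\<one>\<close> form an open subgroup.
\<close>

lemma endpoint_surj:
  assumes "connected_space X" "locally_path_connected_space X"
  shows "endpoint ` carrier P = carrier G"
proof -
  have "openin X (carrier G)" using openin_topspace[of X] by simp
  then obtain W where W: "openin X W" "\<one> \<in> W" "W \<subseteq> carrier G" "\<forall>w\<in>W. \<exists>\<beta>\<in>small W. \<beta> 1 = w"
    by (rule small_path_nbhd[OF assms(2) _ one_closed])
  interpret E: group_hom P G endpoint by unfold_locales (rule endpoint_hom)
  have "W \<subseteq> endpoint ` carrier P"
  proof
    fix w assume "w \<in> W"
    then obtain \<beta> where "\<beta> \<in> small W" "\<beta> 1 = w" using W(4) by blast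
    then show "w \<in> endpoint ` carrier P"
      by (intro image_eqI[of _ _ \<beta>]) (simp_all add: endpoint_def small_def)
  qed
  then show ?thesis
    by (rule open_subgroup_eq_carrier[OF assms(1) E.img_is_subgroup W(1,2)])
qed

end

section \<open>Homotopy classes of loops\<close>

context top_group
begin

lemma loops_extensional: "\<gamma> \<in> L \<Longrightarrow> \<gamma> \<in> extensional {0..1}"
  by (simp add: loops_def)

abbreviation cls where "cls \<equiv> loop_class X \<one>"

lemma loop_homotopyI:
  assumes h: "continuous_map (prod_topology unit_interval unit_interval) X h"
    and ends: "\<And>s. s \<in> {0..1} \<Longrightarrow> h (s, 0) = \<one>" "\<And>s. s \<in> {0..1} \<Longrightarrow> h (s, 1) = \<one>"
  shows "(slice h 0, slice h 1) \<in> loop_homotopy X \<one>"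
proof -
  have "slice h s \<in> L" if "s \<in> {0..1}" for s
    using slice_in_path_group[OF h that] ends[OF that] by (simp add: loops_iff_end slice_def)
  moreover have "homotopic_with (\<lambda>\<eta>. \<eta> 0 = \<one> \<and> \<eta> 1 = \<one>) unit_interval X (slice h 0) (slice h 1)"
    by (subst homotopic_with) (use h ends in \<open>auto simp: slice_def\<close>)
  ultimately show ?thesis by (simp add: loop_homotopy_def)
qed

lemma loop_homotopyE:
  assumes "(\<gamma>, \<delta>) \<in> loop_homotopy X \<one>"
  obtains h where "continuous_map (prod_topology unit_interval unit_interval) X h"
    "\<And>s. s \<in> {0..1} \<Longrightarrow> h (s, 0) = \<one>" "\<And>s. s \<in> {0..1} \<Longrightarrow> h (s, 1) = \<one>"
    "slice h 0 = \<gamma>" "slice h 1 = \<delta>"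
proof -
  from assms have L: "\<gamma> \<in> L" "\<delta> \<in> L"
    and hom: "homotopic_with (\<lambda>\<eta>. \<eta> 0 = \<one> \<and> \<eta> 1 = \<one>) unit_interval X \<gamma> \<delta>"
    by (auto simp: loop_homotopy_def)
  obtain h where h: "continuous_map (prod_topology unit_interval unit_interval) X h"
    "\<And>t. h (0, t) = \<gamma> t" "\<And>t. h (1, t) = \<delta> t"
    "\<And>s. s \<in> {0..1} \<Longrightarrow> h (s, 0) = \<one> \<and> h (s, 1) = \<one>"
    using hom unfolding homotopic_with_def by blast
  have "slice h 0 = \<gamma>" "slice h 1 = \<delta>"
    using L h(2,3) by (simp_all add: slice_eqI loops_extensional)
  with h(1,4) show ?thesis using that by blast
qed

lemma equiv_loop_homotopy: "equiv L (loop_homotopy X \<one>)"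
proof (rule equivI)
  show "refl_on L (loop_homotopy X \<one>)"
    by (auto simp: refl_on_def loop_homotopy_def loops_def)
  show "sym (loop_homotopy X \<one>)"
    by (auto simp: sym_def loop_homotopy_def homotopic_with_sym)
  show "trans (loop_homotopy X \<one>)"
    by (auto simp: trans_def loop_homotopy_def intro: homotopic_with_trans)
  show "loop_homotopy X \<one> \<subseteq> L \<times> L"
    by (auto simp: loop_homotopy_def)
qed

lemma cls_eq_iff:
  "\<gamma> \<in> L \<Longrightarrow> \<delta> \<in> L \<Longrightarrow> cls \<gamma> = cls \<delta> \<longleftrightarrow> (\<gamma>, \<delta>) \<in> loop_homotopy X \<one>"
  unfolding loop_class_def by (rule eq_equiv_class_iff[OF equiv_loop_homotopy])

lemma cls_self: "\<gamma> \<in> L \<Longrightarrow> \<gamma> \<in> cls \<gamma>"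
  unfolding loop_class_def by (rule equiv_class_self[OF equiv_loop_homotopy])

lemma mem_cls_iff: "\<gamma> \<in> L \<Longrightarrow> \<delta> \<in> cls \<gamma> \<longleftrightarrow> \<delta> \<in> L \<and> cls \<delta> = cls \<gamma>"
  using cls_eq_iff[of \<gamma> \<delta>] by (auto simp: loop_class_def loop_homotopy_def)

lemma cls_eqI:
  assumes "continuous_map (prod_topology unit_interval unit_interval) X h"
    "\<And>s. s \<in> {0..1} \<Longrightarrow> h (s, 0) = \<one>" "\<And>s. s \<in> {0..1} \<Longrightarrow> h (s, 1) = \<one>"
    "\<gamma> \<in> L" "\<delta> \<in> L" "\<And>t. t \<in> {0..1} \<Longrightarrow> h (0, t) = \<gamma> t" "\<And>t. t \<in> {0..1} \<Longrightarrow> h (1, t) = \<delta> t"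
  shows "cls \<gamma> = cls \<delta>"
proof -
  have "slice h 0 = \<gamma>" "slice h 1 = \<delta>"
    using assms(4-7) by (auto intro!: slice_eqI loops_extensional)
  then show ?thesis using loop_homotopyI[of h] assms by (simp add: cls_eq_iff)
qed

text \<open>
  Any two reparametrisations of the interval with the same values at the endpoints are homotopic, by
  convexity.
\<close>

definition interpolate :: "(real \<Rightarrow> real) \<Rightarrow> (real \<Rightarrow> real) \<Rightarrow> real \<times> real \<Rightarrow> real" where
  "interpolate r r' = (\<lambda>(s, t). (1 - s) * r t + s * r' t)"

lemma interpolate_in:
  assumes "r t \<in> {0..1}" "r' t \<in> {0..1}" "s \<in> {0..1}"
  shows "interpolate r r' (s, t) \<in> {0..1}"
proof -
  have "(1 - s) *\<^sub>R r t + s *\<^sub>R r' t \<in> {0..1}"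
    by (rule convexD) (use assms in auto)
  then show ?thesis by (simp add: interpolate_def)
qed

lemma interpolate_continuous:
  assumes "continuous_map unit_interval unit_interval r" "continuous_map unit_interval unit_interval r'"
  shows "continuous_map (prod_topology unit_interval unit_interval) unit_interval (interpolate r r')"
proof (rule continuous_map_to_unit_interval)
  have *: "continuous_map (prod_topology unit_interval unit_interval) euclideanreal (\<lambda>z. q (snd z))"
    if "continuous_map unit_interval unit_interval q" for q :: "real \<Rightarrow> real"
    using continuous_map_into_fulltopology[OF continuous_map_compose[OF continuous_map_snd that]]
    unfolding o_def .
  show "continuous_map (prod_topology unit_interval unit_interval) euclideanreal (interpolate r r')"
    unfolding interpolate_def case_prod_unfold
    by (intro continuous_intros * assms real_fst_snd_continuous)
next
  fix z assume "z \<in> topspace (prod_topology unit_interval unit_interval)"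
  then obtain s t where z: "z = (s, t)" "s \<in> {0..1}" "t \<in> {0..1}" by auto
  have "r t \<in> {0..1}" "r' t \<in> {0..1}"
    using assms z(3) by (simp_all only: continuous_map_in_subtopology topspace_euclidean_subtopology Pi_iff)
  then show "interpolate r r' z \<in> {0..1}"
    unfolding z(1) using z(2) by (rule interpolate_in)
qed

text \<open>
  The two factors of a pointwise product may run at independent speeds without changing its homotopy
  class. If one factor rests while the other one moves, the product is a concatenation: this is what
  links pointwise products to concatenations below.
\<close>

lemma pointwise_mult_reparam:
  assumes \<alpha>: "\<alpha> \<in> carrier P" and \<beta>: "\<beta> \<in> carrier P"
    and r: "continuous_map unit_interval unit_interval r" "continuous_map unit_interval unit_interval r'"
    and ends: "r 0 = 0" "r 1 = 1" "r' 0 = 0" "r' 1 = 1"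
  obtains h where "continuous_map (prod_topology unit_interval unit_interval) X h"
    "\<And>s. s \<in> {0..1} \<Longrightarrow> h (s, 0) = \<one>" "\<And>s. s \<in> {0..1} \<Longrightarrow> h (s, 1) = \<alpha> 1 \<otimes> \<beta> 1"
    "\<And>t. t \<in> {0..1} \<Longrightarrow> h (0, t) = \<alpha> (r t) \<otimes> \<beta> (r' t)"
    "\<And>t. t \<in> {0..1} \<Longrightarrow> h (1, t) = \<alpha> t \<otimes> \<beta> t"
proof
  let ?h = "\<lambda>z. \<alpha> (interpolate r id z) \<otimes> \<beta> (interpolate r' id z)"
  have idc: "continuous_map unit_interval unit_interval (id :: real \<Rightarrow> real)" by simp
  show "continuous_map (prod_topology unit_interval unit_interval) X ?h"
    using \<alpha> \<beta> unfolding path_group_simps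
    by (intro cm_mult paths_from_compose[where X = X] interpolate_continuous r idc)
  show "?h (s, 0) = \<one>" "?h (s, 1) = \<alpha> 1 \<otimes> \<beta> 1" if "s \<in> {0..1}" for s
    using ends by (simp_all add: interpolate_def path_at_0 \<alpha> \<beta>)
qed (auto simp: interpolate_def)

lemma cls_loop_concat:
  assumes "\<gamma> \<in> L" "\<delta> \<in> L"
  shows "loop_concat \<gamma> \<delta> \<in> L" "cls (loop_concat \<gamma> \<delta>) = cls (\<gamma> \<otimes>\<^bsub>P\<^esub> \<delta>)"
proof -
  \<comment> \<open>The first factor runs during the first half of the time, the second one during the second half.\<close>
  let ?r = "\<lambda>t::real. min 1 (2 * t)" and ?r' = "\<lambda>t::real. max 0 (2 * t - 1)"
  have r: "continuous_map unit_interval unit_interval ?r" "continuous_map unit_interval unit_interval ?r'"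
    by (rule continuous_map_to_unit_interval;
        simp add: continuous_on_min continuous_on_max continuous_on_mult_left continuous_on_diff)+
  have P: "\<gamma> \<in> carrier P" "\<delta> \<in> carrier P" "\<gamma> 1 = \<one>" "\<delta> 1 = \<one>" using assms by (auto simp: loops_iff_end)
  obtain h where h: "continuous_map (prod_topology unit_interval unit_interval) X h"
    "\<And>s. s \<in> {0..1} \<Longrightarrow> h (s, 0) = \<one>" "\<And>s. s \<in> {0..1} \<Longrightarrow> h (s, 1) = \<gamma> 1 \<otimes> \<delta> 1"
    "\<And>t. t \<in> {0..1} \<Longrightarrow> h (0, t) = \<gamma> (?r t) \<otimes> \<delta> (?r' t)"
    "\<And>t. t \<in> {0..1} \<Longrightarrow> h (1, t) = \<gamma> t \<otimes> \<delta> t"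
    using pointwise_mult_reparam[OF P(1,2) r] by auto
  have eq: "h (0, t) = loop_concat \<gamma> \<delta> t" if t: "t \<in> {0..1}" for t
  proof (cases "t = 1/2")
    case True
    show ?thesis
      unfolding True using h(4)[of "1/2"] P path_at_0[OF P(2)] by (simp add: loop_concat_def)
  next
    case False
    then show ?thesis
      unfolding h(4)[OF t] using t P path_at_0[OF P(1)] path_at_0[OF P(2)]
        path_in_carrier[OF P(1), of "2 * t"] path_in_carrier[OF P(2), of "2 * t - 1"]
      by (auto simp: loop_concat_def min_def max_def)
  qed
  have sl: "slice h 0 = loop_concat \<gamma> \<delta>"
    unfolding slice_def by (rule extensionalityI[of _ "{0..1}"]) (auto simp: eq loop_concat_def)
  have "slice h 0 \<in> carrier P" by (rule slice_in_path_group[OF h(1)]) (use h in auto)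
  moreover have "slice h 0 1 = \<one>" using h(3)[of 0] P by (simp add: slice_def)
  ultimately show L: "loop_concat \<gamma> \<delta> \<in> L" unfolding loops_iff_end sl by simp
  show "cls (loop_concat \<gamma> \<delta>) = cls (\<gamma> \<otimes>\<^bsub>P\<^esub> \<delta>)"
    by (rule cls_eqI[OF h(1)]) (use h P L assms eq in \<open>auto simp: path_at\<close>)
qed

lemma cls_mult_cong:
  assumes L: "\<gamma> \<in> L" "\<gamma>' \<in> L" "\<delta> \<in> L" "\<delta>' \<in> L" and "cls \<gamma> = cls \<gamma>'" "cls \<delta> = cls \<delta>'"
  shows "cls (\<gamma> \<otimes>\<^bsub>P\<^esub> \<delta>) = cls (\<gamma>' \<otimes>\<^bsub>P\<^esub> \<delta>')"
proof -
  obtain h where h: "continuous_map (prod_topology unit_interval unit_interval) X h"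
    "\<And>s. s \<in> {0..1} \<Longrightarrow> h (s, 0) = \<one>" "\<And>s. s \<in> {0..1} \<Longrightarrow> h (s, 1) = \<one>"
    "slice h 0 = \<gamma>" "slice h 1 = \<gamma>'"
    using loop_homotopyE[of \<gamma> \<gamma>'] assms by (auto simp: cls_eq_iff)
  obtain k where k: "continuous_map (prod_topology unit_interval unit_interval) X k"
    "\<And>s. s \<in> {0..1} \<Longrightarrow> k (s, 0) = \<one>" "\<And>s. s \<in> {0..1} \<Longrightarrow> k (s, 1) = \<one>"
    "slice k 0 = \<delta>" "slice k 1 = \<delta>'"
    using loop_homotopyE[of \<delta> \<delta>'] assms by (auto simp: cls_eq_iff)
  show ?thesis
  proof (rule cls_eqI[OF cm_mult[OF h(1) k(1)]])
    show "h (0, t) \<otimes> k (0, t) = (\<gamma> \<otimes>\<^bsub>P\<^esub> \<delta>) t" "h (1, t) \<otimes> k (1, t) = (\<gamma>' \<otimes>\<^bsub>P\<^esub> \<delta>') t"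
      if "t \<in> {0..1}" for t
      unfolding h(4,5)[symmetric] k(4,5)[symmetric] using that by (simp_all add: path_at slice_def)
  qed (use h k L in auto)
qed

abbreviation pi1 where "pi1 \<equiv> fundamental_group X \<one>"

lemma pi1_carrier: "carrier pi1 = cls ` L"
  by (auto simp: fundamental_group_def quotient_def loop_class_def)

lemma pi1_one: "\<one>\<^bsub>pi1\<^esub> = cls \<one>\<^bsub>P\<^esub>"
  by (simp add: fundamental_group_def path_group_simps)

lemma pi1_mult:
  assumes "\<gamma> \<in> L" "\<delta> \<in> L"
  shows "cls \<gamma> \<otimes>\<^bsub>pi1\<^esub> cls \<delta> = cls (\<gamma> \<otimes>\<^bsub>P\<^esub> \<delta>)"
proof -
  have "cls (loop_concat \<gamma>' \<delta>') = cls (\<gamma> \<otimes>\<^bsub>P\<^esub> \<delta>)" if "\<gamma>' \<in> cls \<gamma>" "\<delta>' \<in> cls \<delta>" for \<gamma>' \<delta>'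
  proof -
    have *: "\<gamma>' \<in> L" "\<delta>' \<in> L" "cls \<gamma>' = cls \<gamma>" "cls \<delta>' = cls \<delta>"
      using that assms by (simp_all add: mem_cls_iff)
    show ?thesis
      unfolding cls_loop_concat(2)[OF *(1,2)] using * assms by (intro cls_mult_cong)
  qed
  then have "(\<Union>\<gamma>'\<in>cls \<gamma>. \<Union>\<delta>'\<in>cls \<delta>. cls (loop_concat \<gamma>' \<delta>')) = cls (\<gamma> \<otimes>\<^bsub>P\<^esub> \<delta>)"
    using cls_self[OF assms(1)] cls_self[OF assms(2)] by auto
  then show ?thesis by (simp add: fundamental_group_def)
qed

abbreviation LG where "LG \<equiv> P\<lparr>carrier := L\<rparr>"

lemma group_LG: "group LG"
  by (rule subgroup.subgroup_is_group[OF subgroup_loops group_path_group])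

lemma cls_hom: "cls \<in> hom LG pi1"
  by (auto simp: hom_def pi1_carrier pi1_mult)

lemma group_pi1: "group pi1"
proof -
  interpret LG: group LG by (rule group_LG)
  have "group (pi1\<lparr>carrier := cls ` carrier LG, one := cls \<one>\<^bsub>LG\<^esub>\<rparr>)"
    by (rule LG.hom_imp_img_group[OF cls_hom])
  moreover have "pi1\<lparr>carrier := cls ` carrier LG, one := cls \<one>\<^bsub>LG\<^esub>\<rparr> = pi1"
    using pi1_carrier pi1_one by simp
  ultimately show ?thesis by simp
qed

lemma cls_group_hom: "group_hom LG pi1 cls"
  using group_LG group_pi1 cls_hom by (simp add: group_hom_def group_hom_axioms_def)

definition loops_of :: "(real \<Rightarrow> 'a) set set \<Rightarrow> (real \<Rightarrow> 'a) set" where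
  "loops_of H = {\<gamma> \<in> L. cls \<gamma> \<in> H}"

lemma image_loops_of: "H \<subseteq> carrier pi1 \<Longrightarrow> cls ` loops_of H = H"
  by (auto simp: loops_of_def pi1_carrier)

lemma subgroup_loops_of:
  assumes "subgroup H pi1"
  shows "subgroup (loops_of H) P"
proof -
  interpret cls: group_hom LG pi1 cls by (rule cls_group_hom)
  interpret H: subgroup H pi1 by fact
  have "inv\<^bsub>P\<^esub> \<gamma> \<in> loops_of H" if "\<gamma> \<in> loops_of H" for \<gamma>
  proof -
    have "cls (inv\<^bsub>LG\<^esub> \<gamma>) = inv\<^bsub>pi1\<^esub> (cls \<gamma>)" using that by (intro cls.hom_inv) (simp add: loops_of_def)
    moreover have "inv\<^bsub>LG\<^esub> \<gamma> = inv\<^bsub>P\<^esub> \<gamma>" using that P.m_inv_consistent[OF subgroup_loops] by (simp add: loops_of_def)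
    ultimately show ?thesis using that by (simp add: loops_of_def H.m_inv_closed)
  qed
  moreover have "\<one>\<^bsub>P\<^esub> \<in> loops_of H" using H.one_closed by (simp add: loops_of_def pi1_one)
  moreover have "\<gamma> \<otimes>\<^bsub>P\<^esub> \<delta> \<in> loops_of H" if "\<gamma> \<in> loops_of H" "\<delta> \<in> loops_of H" for \<gamma> \<delta>
    using that H.m_closed[of "cls \<gamma>" "cls \<delta>"] by (simp add: loops_of_def pi1_mult)
  ultimately show ?thesis
    by (intro subgroup.intro) (use loops_subset in \<open>auto simp: loops_of_def\<close>)
qed

lemma subgroup_cls_image:
  assumes "subgroup N P" "N \<subseteq> L"
  shows "subgroup (cls ` N) pi1"
proof -
  have "subgroup N LG" by (rule P.subgroup_incl[OF assms(1) subgroup_loops assms(2)])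
  then show ?thesis by (rule group_hom.subgroup_img_is_subgroup[OF cls_group_hom])
qed

end

section \<open>Open sets of loops\<close>

lemma topspace_loop_space: "topspace (loop_space X x) = loops X x"
proof -
  have "{f \<in> extensional {0..1}. continuous_map unit_interval X f \<and> f ` {} \<subseteq> topspace X}
      \<subseteq> topspace (compact_open_topology unit_interval X)"
    unfolding compact_open_topology_def topology_generated_by_topspace
    by (intro Union_upper CollectI exI[of _ "{}"] exI[of _ "topspace X"]) simp
  then have "loops X x \<subseteq> topspace (compact_open_topology unit_interval X)"
    by (auto simp: loops_def)
  then show ?thesis by (auto simp: loop_space_def)
qed

lemma openin_loop_space_basic:
  assumes "compactin unit_interval K" "openin X U"
  shows "openin (loop_space X x) {\<gamma> \<in> loops X x. \<gamma> ` K \<subseteq> U}"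
proof -
  have "openin (compact_open_topology unit_interval X)
      {f \<in> extensional {0..1}. continuous_map unit_interval X f \<and> f ` K \<subseteq> U}"
    unfolding compact_open_topology_def by (rule topology_generated_by_Basis) (use assms in auto)
  then have "openin (loop_space X x) (loops X x \<inter>
      {f \<in> extensional {0..1}. continuous_map unit_interval X f \<and> f ` K \<subseteq> U})"
    unfolding loop_space_def by (rule openin_subtopology_Int2)
  moreover have "loops X x \<inter> {f \<in> extensional {0..1}. continuous_map unit_interval X f \<and> f ` K \<subseteq> U}
      = {\<gamma> \<in> loops X x. \<gamma> ` K \<subseteq> U}"
    by (auto simp: loops_def)
  ultimately show ?thesis by simp
qed

text \<open>
  Evaluation is jointly continuous because the interval is locally compact: a loop maps a whole compact
  neighbourhood of \<open>t\<close> into \<open>U\<close>, and that condition is open in the compact-open topology.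
\<close>

lemma continuous_map_loop_evaluation:
  "continuous_map (prod_topology (loop_space X x) unit_interval) X (\<lambda>(\<gamma>, t). \<gamma> t)"
proof (unfold continuous_map_def, intro conjI allI impI)
  show "(\<lambda>(\<gamma>, t). \<gamma> t) \<in> topspace (prod_topology (loop_space X x) unit_interval) \<rightarrow> topspace X"
    using continuous_map_image_subset_topspace by (fastforce simp: topspace_loop_space loops_def)
next
  fix U assume U: "openin X U"
  let ?T = "prod_topology (loop_space X x) unit_interval"
  show "openin ?T {z \<in> topspace ?T. (case z of (\<gamma>, t) \<Rightarrow> \<gamma> t) \<in> U}"
    unfolding openin_prod_topology_alt
  proof (intro allI impI)
    fix \<gamma> t assume "(\<gamma>, t) \<in> {z \<in> topspace ?T. (case z of (\<gamma>, t) \<Rightarrow> \<gamma> t) \<in> U}"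
    then have \<gamma>: "\<gamma> \<in> loops X x" and t: "t \<in> {0..1}" "\<gamma> t \<in> U"
      by (auto simp: topspace_loop_space)
    have "openin unit_interval {s \<in> topspace unit_interval. \<gamma> s \<in> U}"
      by (rule openin_continuous_map_preimage[OF _ U]) (use \<gamma> in \<open>simp add: loops_def\<close>)
    moreover have "t \<in> {s \<in> topspace unit_interval. \<gamma> s \<in> U}" using t by simp
    ultimately obtain e where e: "e > 0" "ball t e \<inter> {0..1} \<subseteq> {s \<in> topspace unit_interval. \<gamma> s \<in> U}"
      unfolding openin_contains_ball by blast
    let ?K = "cball t (e/2) \<inter> {0..1}"
    let ?A = "{\<gamma> \<in> loops X x. \<gamma> ` ?K \<subseteq> U}" and ?B = "{0..1} \<inter> ball t (e/2)"
    have "compactin unit_interval ?K"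
      by (simp add: compactin_subtopology compactin_euclidean_iff compact_Int)
    then have "openin (loop_space X x) ?A" by (rule openin_loop_space_basic[OF _ U])
    moreover have "openin unit_interval ?B" by (rule openin_open_Int) simp
    moreover have "cball t (e/2) \<subseteq> ball t e" using e(1) by auto
    then have "\<gamma> \<in> ?A" using \<gamma> e(2) by fastforce
    moreover have "t \<in> ?B" using t e(1) by simp
    moreover have "?A \<times> ?B \<subseteq> {z \<in> topspace ?T. (case z of (\<gamma>, t) \<Rightarrow> \<gamma> t) \<in> U}"
      by (auto simp: topspace_loop_space image_subset_iff)
    ultimately show "\<exists>A B. openin (loop_space X x) A \<and> openin unit_interval B \<and> \<gamma> \<in> A \<and> t \<in> B \<and>
        A \<times> B \<subseteq> {z \<in> topspace ?T. (case z of (\<gamma>, t) \<Rightarrow> \<gamma> t) \<in> U}"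
      by blast
  qed
qed

context top_group
begin

text \<open>
  Loops near \<open>\<gamma>\<close> differ from \<open>\<gamma>\<close> by a small loop, which belongs to \<open>N\<close>.
\<close>

lemma open_subgroup_of_loops:
  assumes N: "subgroup N P" "N \<subseteq> L" and U: "openin X U" "\<one> \<in> U" "L \<inter> small U \<subseteq> N"
  shows "openin (loop_space X \<one>) N"
proof (rule openin_subopen[THEN iffD2], rule ballI)
  interpret N: subgroup N P by fact
  fix \<gamma> assume \<gamma>: "\<gamma> \<in> N"
  then have \<gamma>L: "\<gamma> \<in> L" and \<gamma>P: "\<gamma> \<in> carrier P" using N(2) loops_subset by blast+
  obtain V where V: "openin (loop_space X \<one>) V" "\<gamma> \<in> V"
    "\<And>\<delta> t. \<delta> \<in> V \<Longrightarrow> t \<in> {0..1} \<Longrightarrow> \<delta> t \<otimes> inv (\<gamma> t) \<in> U"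
    using nearby_slices[OF continuous_map_loop_evaluation[of X \<one>] U(1,2), of \<gamma>] \<gamma>L
    unfolding topspace_loop_space prod.case by blast
  have "\<delta> \<in> N" if \<delta>: "\<delta> \<in> V" for \<delta>
  proof -
    have \<delta>L: "\<delta> \<in> L" using openin_subset[OF V(1)] \<delta> by (auto simp: topspace_loop_space)
    then have \<delta>P: "\<delta> \<in> carrier P" using loops_subset by blast
    have "\<delta> \<otimes>\<^bsub>P\<^esub> inv\<^bsub>P\<^esub> \<gamma> \<in> L \<inter> small U"
      using \<gamma>L \<delta>L \<gamma>P \<delta>P V(3)[OF \<delta>] by (simp add: small_def path_at)
    then have "(\<delta> \<otimes>\<^bsub>P\<^esub> inv\<^bsub>P\<^esub> \<gamma>) \<otimes>\<^bsub>P\<^esub> \<gamma> \<in> N"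
      using U(3) \<gamma> by (blast intro: N.m_closed)
    then show ?thesis
      using \<gamma>P \<delta>P by (simp add: P.m_assoc)
  qed
  then show "\<exists>T. openin (loop_space X \<one>) T \<and> \<gamma> \<in> T \<and> T \<subseteq> N"
    using V(1,2) by blast
qed

text \<open>
  Near the constant loop, every condition that defines the compact-open topology is implied by
  staying in one neighbourhood of \<open>\<one>\<close>: \<open>\<gamma> ` K \<subseteq> U\<close> with \<open>K\<close> nonempty forces \<open>\<one> \<in> U\<close>.
\<close>

lemma small_loops_in_open:
  assumes N: "openin (loop_space X \<one>) N" "\<one>\<^bsub>P\<^esub> \<in> N"
  obtains U where "openin X U" "\<one> \<in> U" "L \<inter> small U \<subseteq> N"
proof -
  let ?S = "{{f \<in> extensional (topspace unit_interval). continuous_map unit_interval X f \<and> f ` K \<subseteq> U} | K U.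
          compactin unit_interval K \<and> openin X U}"
  have "\<exists>U. openin X U \<and> \<one> \<in> U \<and> L \<inter> small U \<subseteq> W"
    if "generate_topology_on ?S W" "\<one>\<^bsub>P\<^esub> \<in> W" for W
    using that
  proof (induction rule: generate_topology_on.induct)
    case (Int a b)
    then obtain U V where "openin X U" "\<one> \<in> U" "L \<inter> small U \<subseteq> a" "openin X V" "\<one> \<in> V" "L \<inter> small V \<subseteq> b"
      by auto
    then show ?case
      using small_mono[of "U \<inter> V" U] small_mono[of "U \<inter> V" V]
      by (intro exI[of _ "U \<inter> V"]) auto
  next
    case (Basis s)
    then obtain K U where s: "s = {f \<in> extensional {0..1}. continuous_map unit_interval X f \<and> f ` K \<subseteq> U}"
      and K: "compactin unit_interval K" and U: "openin X U" by auto
    have KI: "K \<subseteq> {0..1}" using compactin_subset_topspace[OF K] by simp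
    show ?case
    proof (cases "K = {}")
      case True
      have "openin X (carrier G)" using openin_topspace[of X] by simp
      then show ?thesis
        by (intro exI[of _ "carrier G"]) (auto simp: s True loops_def)
    next
      case False
      then have "\<one> \<in> U" using Basis(2) KI by (force simp: s path_group_simps)
      moreover have "L \<inter> small U \<subseteq> s" using KI by (auto simp: s small_def loops_def)
      ultimately show ?thesis using U by blast
    qed
  next
    case (UN K)
    then obtain k where k: "k \<in> K" "\<one>\<^bsub>P\<^esub> \<in> k" by blast
    then obtain U where "openin X U" "\<one> \<in> U" "L \<inter> small U \<subseteq> k" using UN.IH[OF k] by blast
    then show ?case using k(1) by (intro exI[of _ U]) blast
  qed simp
  note * = this
  obtain W where W: "openin (compact_open_topology unit_interval X) W" "N = W \<inter> L"
    using N(1) unfolding loop_space_def openin_subtopology by (elim exE conjE)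
  have "generate_topology_on ?S W"
    using W(1) unfolding compact_open_topology_def by (rule openin_topology_generated_by)
  moreover have "\<one>\<^bsub>P\<^esub> \<in> W" using N(2) W(2) by blast
  ultimately obtain U where "openin X U" "\<one> \<in> U" "L \<inter> small U \<subseteq> W"
    using * by blast
  then show ?thesis using that W(2) by blast
qed

lemma openin_qtop_iff:
  "openin (fundamental_group_qtop X \<one>) H \<longleftrightarrow> H \<subseteq> carrier pi1 \<and> openin (loop_space X \<one>) (loops_of H)"
  by (simp add: fundamental_group_qtop_def openin_quotient_topology topspace_loop_space pi1_carrier loops_of_def)

text \<open>
  The conjugating path can be shrunk to the constant one along its initial pieces. At the ends of
  \<open>\<gamma>\<close> the conjugated value is \<open>\<one>\<close> at every stage, so the homotopy consists of loops.
\<close>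

lemma cls_conj:
  assumes \<alpha>: "\<alpha> \<in> carrier P" and \<gamma>: "\<gamma> \<in> L"
  shows "cls (\<alpha> \<otimes>\<^bsub>P\<^esub> \<gamma> \<otimes>\<^bsub>P\<^esub> inv\<^bsub>P\<^esub> \<alpha>) = cls \<gamma>"
proof (rule sym, rule cls_eqI)
  let ?h = "\<lambda>(s, t). \<alpha> (s * t) \<otimes> \<gamma> t \<otimes> inv (\<alpha> (s * t))"
  have \<gamma>P: "\<gamma> \<in> carrier P" using \<gamma> loops_subset by blast
  have r: "continuous_map (prod_topology unit_interval unit_interval) unit_interval (\<lambda>z. fst z * snd z)"
    by (rule continuous_map_to_unit_interval)
       (auto intro!: continuous_intros real_fst_snd_continuous simp: mult_le_one)
  show "continuous_map (prod_topology unit_interval unit_interval) X ?h"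
    using \<alpha> \<gamma>P unfolding path_group_simps case_prod_unfold
    by (intro cm_mult cm_inv paths_from_compose[where X = X] r continuous_map_snd)
  show "?h (s, 0) = \<one>" "?h (s, 1) = \<one>" if "s \<in> {0..1}" for s
    using \<gamma> path_at_0[OF \<alpha>] path_at_0[OF \<gamma>P] path_in_carrier[OF \<alpha> that] by (auto simp: loops_iff_end)
  show "\<gamma> \<in> L" by fact
  show "\<alpha> \<otimes>\<^bsub>P\<^esub> \<gamma> \<otimes>\<^bsub>P\<^esub> inv\<^bsub>P\<^esub> \<alpha> \<in> L"
    using \<alpha> \<gamma> \<gamma>P path_in_carrier[OF \<alpha>, of 1] by (auto simp: loops_iff_end path_at)
  show "?h (0, t) = \<gamma> t" "?h (1, t) = (\<alpha> \<otimes>\<^bsub>P\<^esub> \<gamma> \<otimes>\<^bsub>P\<^esub> inv\<^bsub>P\<^esub> \<alpha>) t" if "t \<in> {0..1}" for t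
    using that path_at_0[OF \<alpha>] path_in_carrier[OF \<gamma>P that] \<alpha> by (auto simp: path_at)
qed

lemma normal_loops_of:
  assumes "subgroup H pi1"
  shows "loops_of H \<lhd> P"
  unfolding P.normal_inv_iff
proof (intro conjI ballI)
  show "subgroup (loops_of H) P" by (rule subgroup_loops_of[OF assms])
  fix \<alpha> \<gamma> assume \<alpha>: "\<alpha> \<in> carrier P" and "\<gamma> \<in> loops_of H"
  then have \<gamma>: "\<gamma> \<in> L" "cls \<gamma> \<in> H" by (auto simp: loops_of_def)
  have "\<alpha> \<otimes>\<^bsub>P\<^esub> \<gamma> \<otimes>\<^bsub>P\<^esub> inv\<^bsub>P\<^esub> \<alpha> \<in> L"
    using \<alpha> \<gamma> path_in_carrier[OF \<alpha>, of 1] by (auto simp: loops_iff_end path_at)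
  then show "\<alpha> \<otimes>\<^bsub>P\<^esub> \<gamma> \<otimes>\<^bsub>P\<^esub> inv\<^bsub>P\<^esub> \<alpha> \<in> loops_of H"
    using \<gamma> by (simp add: loops_of_def cls_conj[OF \<alpha>])
qed

end

section \<open>The covering group of a group of loops\<close>

text \<open>
  The assumptions on \<open>N\<close> are shared by the loops whose class lies in an open subgroup of the
  fundamental group and by the loops that lift to closed loops of a given covering group, so that
  the construction serves both directions of the classification.
\<close>

locale loop_covering = top_group G X for G :: "'a monoid" (structure) and X :: "'a topology" +
  fixes N :: "(real \<Rightarrow> 'a) set"
  assumes connected: "connected_space X"
    and locally_path_connected: "locally_path_connected_space X"
    and normal: "N \<lhd> P"
    and N_loops: "N \<subseteq> L"
    and N_homotopy: "\<gamma> \<in> N \<Longrightarrow> \<delta> \<in> L \<Longrightarrow> cls \<gamma> = cls \<delta> \<Longrightarrow> \<delta> \<in> N"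
    and N_small: "\<exists>U. openin X U \<and> \<one> \<in> U \<and> L \<inter> small U \<subseteq> N"
begin

sublocale N: normal N P
  by (rule normal)

definition coset :: "(real \<Rightarrow> 'a) \<Rightarrow> (real \<Rightarrow> 'a) set" where
  "coset \<alpha> = N #>\<^bsub>P\<^esub> \<alpha>"

abbreviation Q where "Q \<equiv> P Mod N"

declare mult_FactGroup [simp del]

lemma group_Q: "group Q"
  by (rule N.factorgroup_is_group)

sublocale Q: group Q
  by (rule group_Q)

lemma coset_hom: "coset \<in> hom P Q"
  unfolding coset_def by (rule N.r_coset_hom_Mod)

sublocale coset: group_hom P Q coset
  by unfold_locales (rule coset_hom)

lemma carrier_Q: "carrier Q = coset ` carrier P"
  by (auto simp: FactGroup_def RCOSETS_def coset_def)

lemma coset_eq_iff: "\<alpha> \<in> carrier P \<Longrightarrow> \<beta> \<in> carrier P \<Longrightarrow> coset \<alpha> = coset \<beta> \<longleftrightarrow> \<alpha> \<otimes>\<^bsub>P\<^esub> inv\<^bsub>P\<^esub> \<beta> \<in> N"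
  unfolding coset_def
  by (metis N.rcos_module P.group_axioms P.rcos_self P.repr_independence N.subgroup_axioms)

text \<open>
  Paths that are homotopic relative to their endpoints differ by a null-homotopic loop.
\<close>

lemma coset_homotopy_eq:
  assumes h: "continuous_map (prod_topology unit_interval unit_interval) X h"
    and ends: "\<And>s. s \<in> {0..1} \<Longrightarrow> h (s, 0) = \<one>" "\<And>s. s \<in> {0..1} \<Longrightarrow> h (s, 1) = x"
    and \<alpha>: "\<alpha> \<in> carrier P" "\<And>t. t \<in> {0..1} \<Longrightarrow> h (0, t) = \<alpha> t"
    and \<beta>: "\<beta> \<in> carrier P" "\<And>t. t \<in> {0..1} \<Longrightarrow> h (1, t) = \<beta> t"
  shows "coset \<alpha> = coset \<beta>"
proof -
  let ?k = "\<lambda>z. h z \<otimes> inv (\<beta> (snd z))"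
  have ab: "\<alpha> 1 = x" "\<beta> 1 = x" using ends(2)[of 0] ends(2)[of 1] \<alpha>(2)[of 1] \<beta>(2)[of 1] by auto
  have xG: "x \<in> carrier G" using path_in_carrier[OF \<beta>(1), of 1] ab by simp
  have dL: "\<alpha> \<otimes>\<^bsub>P\<^esub> inv\<^bsub>P\<^esub> \<beta> \<in> L"
    using \<alpha>(1) \<beta>(1) ab xG by (simp add: loops_iff_end path_at)
  have "cls (\<alpha> \<otimes>\<^bsub>P\<^esub> inv\<^bsub>P\<^esub> \<beta>) = cls \<one>\<^bsub>P\<^esub>"
  proof (rule cls_eqI[of ?k])
    show "continuous_map (prod_topology unit_interval unit_interval) X ?k"
      using \<beta>(1) unfolding path_group_simps
      by (intro cm_mult cm_inv h paths_from_compose[where X = X] continuous_map_snd)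
    show "?k (s, 0) = \<one>" "?k (s, 1) = \<one>" if "s \<in> {0..1}" for s
      using ends[OF that] path_at_0[OF \<beta>(1)] ab xG by simp_all
    show "?k (0, t) = (\<alpha> \<otimes>\<^bsub>P\<^esub> inv\<^bsub>P\<^esub> \<beta>) t" "?k (1, t) = \<one>\<^bsub>P\<^esub> t" if "t \<in> {0..1}" for t
      using that \<alpha> \<beta> path_in_carrier[OF \<beta>(1) that] by (simp_all add: path_at)
  qed (use dL in auto)
  then have "\<alpha> \<otimes>\<^bsub>P\<^esub> inv\<^bsub>P\<^esub> \<beta> \<in> N"
    using N_homotopy[OF N.one_closed dL] by simp
  then show ?thesis using coset_eq_iff \<alpha>(1) \<beta>(1) by simp
qed

text \<open>
  Here the conjugating path is pushed to its endpoint instead, which keeps the endpoint of the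
  conjugate fixed. It turns conjugation by a path into conjugation by an element of \<open>G\<close>, where
  continuity of the group operations applies.
\<close>

lemma coset_conj_endpoint:
  assumes \<alpha>: "\<alpha> \<in> carrier P" and \<beta>: "\<beta> \<in> carrier P"
  shows "coset (\<alpha> \<otimes>\<^bsub>P\<^esub> \<beta> \<otimes>\<^bsub>P\<^esub> inv\<^bsub>P\<^esub> \<alpha>) = coset (restrict (\<lambda>t. \<alpha> 1 \<otimes> \<beta> t \<otimes> inv (\<alpha> 1)) {0..1})"
proof -
  have a: "\<alpha> 1 \<in> carrier G" using path_in_carrier[OF \<alpha>, of 1] by simp
  let ?r = "interpolate id (\<lambda>_. 1)"
  let ?h = "\<lambda>z. \<alpha> (?r z) \<otimes> \<beta> (snd z) \<otimes> inv (\<alpha> (?r z))"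
  have r: "continuous_map (prod_topology unit_interval unit_interval) unit_interval ?r"
    by (rule interpolate_continuous) simp_all
  show ?thesis
  proof (rule coset_homotopy_eq[of ?h "\<alpha> 1 \<otimes> \<beta> 1 \<otimes> inv (\<alpha> 1)"])
    show "continuous_map (prod_topology unit_interval unit_interval) X ?h"
      using \<alpha> \<beta> unfolding path_group_simps
      by (intro cm_mult cm_inv paths_from_compose[where X = X] r continuous_map_snd)
    show "?h (s, 0) = \<one>" if "s \<in> {0..1}" for s
      using path_at_0[OF \<beta>] path_in_carrier[OF \<alpha> interpolate_in[of id 0 "\<lambda>_. 1" s]] that by simp
    show "restrict (\<lambda>t. \<alpha> 1 \<otimes> \<beta> t \<otimes> inv (\<alpha> 1)) {0..1} \<in> carrier P"
      by (rule restrict_in_path_group[OF cm_mult[OF cm_mult]]) (use a \<beta> in \<open>simp_all add: path_continuous path_at_0\<close>)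
  qed (use \<alpha> \<beta> in \<open>auto simp: interpolate_def path_at\<close>)
qed

definition sheet :: "'a set \<Rightarrow> (real \<Rightarrow> 'a) \<Rightarrow> (real \<Rightarrow> 'a) set set" where
  "sheet U \<alpha> = (\<lambda>\<beta>. coset (\<beta> \<otimes>\<^bsub>P\<^esub> \<alpha>)) ` small U"

text \<open>
  The sheets \<open>sheet U \<alpha>\<close>, for neighbourhoods \<open>U\<close> of \<open>\<one>\<close>, are to be a neighbourhood base at the coset of
  \<open>\<alpha>\<close>. Formulating openness this way makes the topology axioms immediate and moves the work to
  \<open>openin_sheet\<close>.
\<close>

definition cover_open :: "(real \<Rightarrow> 'a) set set \<Rightarrow> bool" where
  "cover_open W \<longleftrightarrow> W \<subseteq> carrier Q \<and>
     (\<forall>\<alpha>\<in>carrier P. coset \<alpha> \<in> W \<longrightarrow> (\<exists>U. openin X U \<and> \<one> \<in> U \<and> sheet U \<alpha> \<subseteq> W))"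

definition T :: "(real \<Rightarrow> 'a) set topology" where
  "T = topology cover_open"

lemma sheet_mono: "U \<subseteq> V \<Longrightarrow> sheet U \<alpha> \<subseteq> sheet V \<alpha>"
  unfolding sheet_def by (rule image_mono[OF small_mono])

lemma small_carrier: "\<beta> \<in> small U \<Longrightarrow> \<beta> \<in> carrier P"
  by (simp add: small_def)

lemma sheet_subset: "\<alpha> \<in> carrier P \<Longrightarrow> sheet U \<alpha> \<subseteq> carrier Q"
  by (auto simp: sheet_def carrier_Q small_carrier simp del: coset.hom_mult)

lemma sheet_coset_cong:
  assumes "\<alpha> \<in> carrier P" "\<beta> \<in> carrier P" "coset \<alpha> = coset \<beta>"
  shows "sheet U \<alpha> = sheet U \<beta>"
  unfolding sheet_def by (rule image_cong) (use assms in \<open>simp_all add: small_carrier\<close>)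

lemma one_small: "\<one> \<in> U \<Longrightarrow> \<one>\<^bsub>P\<^esub> \<in> small U"
  by (auto simp: small_def path_at)

lemma coset_in_sheet: "\<one> \<in> U \<Longrightarrow> \<alpha> \<in> carrier P \<Longrightarrow> coset \<alpha> \<in> sheet U \<alpha>"
  unfolding sheet_def using one_small[of U] P.l_one[of \<alpha>] by force

lemma openin_T: "openin T W \<longleftrightarrow> cover_open W"
proof -
  have "istopology cover_open"
    unfolding istopology_def
  proof (intro conjI allI impI)
    fix V W assume "cover_open V" "cover_open W"
    then show "cover_open (V \<inter> W)"
      unfolding cover_open_def
    proof (intro conjI ballI impI)
      fix \<alpha> assume \<alpha>: "\<alpha> \<in> carrier P" "coset \<alpha> \<in> V \<inter> W"
      then obtain A B where "openin X A" "\<one> \<in> A" "sheet A \<alpha> \<subseteq> V" "openin X B" "\<one> \<in> B" "sheet B \<alpha> \<subseteq> W"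
        using \<open>cover_open V\<close> \<open>cover_open W\<close> unfolding cover_open_def by blast
      then show "\<exists>U. openin X U \<and> \<one> \<in> U \<and> sheet U \<alpha> \<subseteq> V \<inter> W"
        using sheet_mono[of "A \<inter> B" A \<alpha>] sheet_mono[of "A \<inter> B" B \<alpha>] by (intro exI[of _ "A \<inter> B"]) auto
    qed auto
  next
    fix \<K> assume "\<forall>K\<in>\<K>. cover_open K"
    then show "cover_open (\<Union>\<K>)"
      unfolding cover_open_def by (meson Sup_least UnionE Union_upper subset_trans)
  qed
  then show ?thesis by (simp add: T_def topology_inverse')
qed

lemma topspace_T: "topspace T = carrier Q"
proof -
  have "cover_open (carrier Q)"
    unfolding cover_open_def using openin_topspace[of X] by (auto intro!: exI[of _ "carrier G"] sheet_subset)
  then have "openin T (carrier Q)" by (simp add: openin_T)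
  then show ?thesis
    by (meson openin_T cover_open_def openin_subset openin_topspace subset_antisym)
qed

text \<open>
  If \<open>\<beta>\<close> runs in \<open>U\<close> and \<open>\<delta>\<close> is so small that \<open>\<delta> t \<otimes> \<beta> 1\<close> remains in \<open>U\<close>, then \<open>\<delta> \<beta>\<close> can be
  deformed, with fixed endpoints, to the path that first runs through \<open>\<beta>\<close> and then through
  \<open>\<delta> (\<beta> 1)\<close>, and that path lies in \<open>U\<close>.
\<close>

lemma openin_sheet:
  assumes U: "openin X U" and \<alpha>: "\<alpha> \<in> carrier P"
  shows "openin T (sheet U \<alpha>)"
  unfolding openin_T cover_open_def
proof (intro conjI ballI impI sheet_subset[OF \<alpha>])
  fix \<gamma> assume \<gamma>: "\<gamma> \<in> carrier P" "coset \<gamma> \<in> sheet U \<alpha>"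
  then obtain \<beta> where \<beta>: "\<beta> \<in> small U" "coset \<gamma> = coset (\<beta> \<otimes>\<^bsub>P\<^esub> \<alpha>)" by (auto simp: sheet_def)
  have \<beta>P: "\<beta> \<in> carrier P" and \<beta>U: "\<And>t. t \<in> {0..1} \<Longrightarrow> \<beta> t \<in> U" using \<beta>(1) by (auto simp: small_def)
  have b: "\<beta> 1 \<in> carrier G" using path_in_carrier[OF \<beta>P, of 1] by simp
  let ?V = "{x \<in> carrier G. x \<otimes> \<beta> 1 \<in> U}"
  have V: "openin X ?V" by (rule open_mult_vimage[OF U b])
  have "\<one> \<in> ?V" using b \<beta>U[of 1] by simp
  have "coset (\<delta> \<otimes>\<^bsub>P\<^esub> \<gamma>) \<in> sheet U \<alpha>" if \<delta>: "\<delta> \<in> small ?V" for \<delta>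
  proof -
    have \<delta>P: "\<delta> \<in> carrier P" and \<delta>V: "\<And>t. t \<in> {0..1} \<Longrightarrow> \<delta> t \<otimes> \<beta> 1 \<in> U" using \<delta> by (auto simp: small_def)
    \<comment> \<open>\<open>\<beta>\<close> runs first, while \<open>\<delta>\<close> rests at \<open>\<one>\<close>; then \<open>\<delta>\<close> runs while \<open>\<beta>\<close> rests at its endpoint.\<close>
    let ?r = "\<lambda>t::real. min 1 (2 * t)" and ?r' = "\<lambda>t::real. max 0 (2 * t - 1)"
    have r: "continuous_map unit_interval unit_interval ?r'" "continuous_map unit_interval unit_interval ?r"
      by (rule continuous_map_to_unit_interval;
          simp add: continuous_on_min continuous_on_max continuous_on_mult_left continuous_on_diff)+
    obtain h where h: "continuous_map (prod_topology unit_interval unit_interval) X h"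
      "\<And>s. s \<in> {0..1} \<Longrightarrow> h (s, 0) = \<one>" "\<And>s. s \<in> {0..1} \<Longrightarrow> h (s, 1) = \<delta> 1 \<otimes> \<beta> 1"
      "\<And>t. t \<in> {0..1} \<Longrightarrow> h (0, t) = \<delta> (?r' t) \<otimes> \<beta> (?r t)"
      "\<And>t. t \<in> {0..1} \<Longrightarrow> h (1, t) = \<delta> t \<otimes> \<beta> t"
      using pointwise_mult_reparam[OF \<delta>P \<beta>P r] by auto
    have h0: "slice h 0 \<in> carrier P" by (rule slice_in_path_group[OF h(1)]) (use h(2) in auto)
    have "h (0, t) \<in> U" if t: "t \<in> {0..1}" for t
    proof (cases "t \<le> 1/2")
      case True
      then have r: "?r' t = 0" "?r t = 2 * t" by simp_all
      have "h (0, t) = \<beta> (2 * t)"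
        unfolding h(4)[OF t] r using t True path_at_0[OF \<delta>P] path_in_carrier[OF \<beta>P, of "2 * t"] by simp
      then show ?thesis using \<beta>U[of "2 * t"] t True by simp
    next
      case False
      then have "h (0, t) = \<delta> (2 * t - 1) \<otimes> \<beta> 1"
        unfolding h(4)[OF t] using t by (simp add: min_def max_def)
      then show ?thesis using \<delta>V[of "2 * t - 1"] t False by simp
    qed
    then have sm: "slice h 0 \<in> small U" using h0 by (simp add: small_def slice_def)
    have "coset (slice h 0) = coset (\<delta> \<otimes>\<^bsub>P\<^esub> \<beta>)"
      by (rule coset_homotopy_eq[OF h(1-3)])
         (use h0 \<delta>P \<beta>P in \<open>simp_all add: slice_def path_at h(5)\<close>)
    then have "coset (slice h 0 \<otimes>\<^bsub>P\<^esub> \<alpha>) = coset (\<delta> \<otimes>\<^bsub>P\<^esub> \<gamma>)"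
      using h0 \<delta>P \<beta>P \<alpha> \<gamma>(1) \<beta>(2) by (simp add: Q.m_assoc)
    then show ?thesis using sm unfolding sheet_def by (metis image_eqI)
  qed
  then have "sheet ?V \<gamma> \<subseteq> sheet U \<alpha>" by (auto simp: sheet_def[of ?V])
  then show "\<exists>V. openin X V \<and> \<one> \<in> V \<and> sheet V \<gamma> \<subseteq> sheet U \<alpha>"
    using V \<open>\<one> \<in> ?V\<close> by blast
qed

lemma openin_T_sheetD:
  assumes "openin T W" "\<alpha> \<in> carrier P" "coset \<alpha> \<in> W"
  obtains U where "openin X U" "\<one> \<in> U" "sheet U \<alpha> \<subseteq> W"
  using assms unfolding openin_T cover_open_def by blast

text \<open>
  A product of nearby points is \<open>\<gamma> \<alpha> \<delta> \<beta> = \<gamma> (\<alpha> \<delta> \<alpha>\<^sup>-\<^sup>1) \<alpha> \<beta>\<close>. By \<open>coset_conj_endpoint\<close> the middle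
  factor may be replaced by the conjugate of \<open>\<delta>\<close> with the single element \<open>\<alpha> 1\<close>, which is small
  when \<open>\<delta>\<close> is small. Inversion is treated in the same way.
\<close>

lemma continuous_mult_Q: "continuous_map (prod_topology T T) T (\<lambda>(x, y). x \<otimes>\<^bsub>Q\<^esub> y)"
proof (unfold continuous_map_def, intro conjI allI impI)
  fix W assume W: "openin T W"
  show "openin (prod_topology T T) {z \<in> topspace (prod_topology T T). (case z of (x, y) \<Rightarrow> x \<otimes>\<^bsub>Q\<^esub> y) \<in> W}"
    unfolding openin_prod_topology_alt
  proof (intro allI impI)
    fix x y assume "(x, y) \<in> {z \<in> topspace (prod_topology T T). (case z of (x, y) \<Rightarrow> x \<otimes>\<^bsub>Q\<^esub> y) \<in> W}"
    then have "x \<in> carrier Q" "y \<in> carrier Q" and W': "x \<otimes>\<^bsub>Q\<^esub> y \<in> W" by (auto simp: topspace_T)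
    then obtain \<alpha> \<beta> where \<alpha>: "\<alpha> \<in> carrier P" "x = coset \<alpha>" and \<beta>: "\<beta> \<in> carrier P" "y = coset \<beta>"
      by (auto simp: carrier_Q)
    have "coset (\<alpha> \<otimes>\<^bsub>P\<^esub> \<beta>) \<in> W" using W' \<alpha> \<beta> by simp
    then obtain U where U: "openin X U" "\<one> \<in> U" "sheet U (\<alpha> \<otimes>\<^bsub>P\<^esub> \<beta>) \<subseteq> W"
      using openin_T_sheetD[OF W] \<alpha>(1) \<beta>(1) by blast
    obtain V where V: "openin X V" "\<one> \<in> V" "\<And>x y. x \<in> V \<Longrightarrow> y \<in> V \<Longrightarrow> x \<otimes> y \<in> U"
      using one_nbhd_mult[OF U(1,2)] by blast
    have a: "\<alpha> 1 \<in> carrier G" using path_in_carrier[OF \<alpha>(1), of 1] by simp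
    let ?V' = "{x \<in> carrier G. \<alpha> 1 \<otimes> x \<otimes> inv (\<alpha> 1) \<in> V}"
    have V': "openin X ?V'" "\<one> \<in> ?V'" using open_conj_vimage[OF V(1) a] a V(2) by simp_all
    have "coset (\<gamma> \<otimes>\<^bsub>P\<^esub> \<alpha>) \<otimes>\<^bsub>Q\<^esub> coset (\<delta> \<otimes>\<^bsub>P\<^esub> \<beta>) \<in> W" if \<gamma>: "\<gamma> \<in> small V" and \<delta>: "\<delta> \<in> small ?V'" for \<gamma> \<delta>
    proof -
      have P: "\<gamma> \<in> carrier P" "\<delta> \<in> carrier P" using \<gamma> \<delta> by (auto simp: small_def)
      let ?c = "restrict (\<lambda>t. \<alpha> 1 \<otimes> \<delta> t \<otimes> inv (\<alpha> 1)) {0..1}"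
      have c: "?c \<in> carrier P"
        by (rule restrict_in_path_group[OF cm_mult[OF cm_mult]]) (use a P in \<open>simp_all add: path_continuous path_at_0\<close>)
      have "\<gamma> \<otimes>\<^bsub>P\<^esub> ?c \<in> small U"
        using \<gamma> \<delta> c V(3) by (auto simp: small_def path_at)
      then have "coset ((\<gamma> \<otimes>\<^bsub>P\<^esub> ?c) \<otimes>\<^bsub>P\<^esub> (\<alpha> \<otimes>\<^bsub>P\<^esub> \<beta>)) \<in> W" using U(3) by (auto simp: sheet_def)
      moreover have "coset ((\<gamma> \<otimes>\<^bsub>P\<^esub> ?c) \<otimes>\<^bsub>P\<^esub> (\<alpha> \<otimes>\<^bsub>P\<^esub> \<beta>)) = coset (\<gamma> \<otimes>\<^bsub>P\<^esub> (\<alpha> \<otimes>\<^bsub>P\<^esub> \<delta> \<otimes>\<^bsub>P\<^esub> inv\<^bsub>P\<^esub> \<alpha>) \<otimes>\<^bsub>P\<^esub> (\<alpha> \<otimes>\<^bsub>P\<^esub> \<beta>))"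
        using coset_conj_endpoint[OF \<alpha>(1) P(2)] P c \<alpha>(1) \<beta>(1) by simp
      moreover have "\<gamma> \<otimes>\<^bsub>P\<^esub> (\<alpha> \<otimes>\<^bsub>P\<^esub> \<delta> \<otimes>\<^bsub>P\<^esub> inv\<^bsub>P\<^esub> \<alpha>) \<otimes>\<^bsub>P\<^esub> (\<alpha> \<otimes>\<^bsub>P\<^esub> \<beta>) = (\<gamma> \<otimes>\<^bsub>P\<^esub> \<alpha>) \<otimes>\<^bsub>P\<^esub> (\<delta> \<otimes>\<^bsub>P\<^esub> \<beta>)"
        using P \<alpha>(1) \<beta>(1) by (simp add: P.m_assoc P.inv_solve_left')
      ultimately show ?thesis using P \<alpha>(1) \<beta>(1) by simp
    qed
    then have "sheet V \<alpha> \<times> sheet ?V' \<beta> \<subseteq> {z \<in> topspace (prod_topology T T). (case z of (x, y) \<Rightarrow> x \<otimes>\<^bsub>Q\<^esub> y) \<in> W}"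
      using sheet_subset[OF \<alpha>(1), of V] sheet_subset[OF \<beta>(1), of ?V'] by (auto simp: topspace_T sheet_def)
    then show "\<exists>A B. openin T A \<and> openin T B \<and> x \<in> A \<and> y \<in> B \<and>
        A \<times> B \<subseteq> {z \<in> topspace (prod_topology T T). (case z of (x, y) \<Rightarrow> x \<otimes>\<^bsub>Q\<^esub> y) \<in> W}"
      using openin_sheet[OF V(1) \<alpha>(1)] openin_sheet[OF V'(1) \<beta>(1)] \<alpha> \<beta>
        coset_in_sheet[OF V(2) \<alpha>(1)] coset_in_sheet[OF V'(2) \<beta>(1)] by blast
  qed
qed (auto simp: topspace_T)

lemma continuous_inv_Q: "continuous_map T T (\<lambda>x. inv\<^bsub>Q\<^esub> x)"
proof (unfold continuous_map_def, intro conjI allI impI)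
  fix W assume W: "openin T W"
  show "openin T {x \<in> topspace T. inv\<^bsub>Q\<^esub> x \<in> W}"
    unfolding openin_T cover_open_def
  proof (intro conjI ballI impI)
    fix \<alpha> assume \<alpha>: "\<alpha> \<in> carrier P" "coset \<alpha> \<in> {x \<in> topspace T. inv\<^bsub>Q\<^esub> x \<in> W}"
    then have "coset (inv\<^bsub>P\<^esub> \<alpha>) \<in> W" by simp
    then obtain U where U: "openin X U" "\<one> \<in> U" "sheet U (inv\<^bsub>P\<^esub> \<alpha>) \<subseteq> W"
      using openin_T_sheetD[OF W] \<alpha>(1) by blast
    have a: "\<alpha> 1 \<in> carrier G" using path_in_carrier[OF \<alpha>(1), of 1] by simp
    let ?V1 = "{x \<in> carrier G. inv (\<alpha> 1) \<otimes> x \<otimes> inv (inv (\<alpha> 1)) \<in> U}"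
    let ?V = "{x \<in> carrier G. inv x \<in> ?V1}"
    have V: "openin X ?V" by (rule open_inv_vimage[OF open_conj_vimage[OF U(1)]]) (use a in simp)
    have V1: "\<one> \<in> ?V" using a U(2) by simp
    have "inv\<^bsub>Q\<^esub> coset (\<beta> \<otimes>\<^bsub>P\<^esub> \<alpha>) \<in> W" if \<beta>: "\<beta> \<in> small ?V" for \<beta>
    proof -
      have P: "\<beta> \<in> carrier P" using \<beta> by (auto simp: small_def)
      let ?c = "restrict (\<lambda>t. (inv\<^bsub>P\<^esub> \<alpha>) 1 \<otimes> (inv\<^bsub>P\<^esub> \<beta>) t \<otimes> inv ((inv\<^bsub>P\<^esub> \<alpha>) 1)) {0..1}"
      have c: "?c \<in> carrier P"
        by (rule restrict_in_path_group[OF cm_mult[OF cm_mult]])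
           (use a P \<alpha>(1) in \<open>simp_all add: path_continuous path_at_0 path_inv_at\<close>)
      have "?c \<in> small U"
        using \<beta> c P \<alpha>(1) by (auto simp: small_def path_at)
      then have "coset (?c \<otimes>\<^bsub>P\<^esub> inv\<^bsub>P\<^esub> \<alpha>) \<in> W" using U(3) by (auto simp: sheet_def)
      moreover have "coset (?c \<otimes>\<^bsub>P\<^esub> inv\<^bsub>P\<^esub> \<alpha>) = coset (inv\<^bsub>P\<^esub> \<alpha> \<otimes>\<^bsub>P\<^esub> inv\<^bsub>P\<^esub> \<beta> \<otimes>\<^bsub>P\<^esub> inv\<^bsub>P\<^esub> (inv\<^bsub>P\<^esub> \<alpha>) \<otimes>\<^bsub>P\<^esub> inv\<^bsub>P\<^esub> \<alpha>)"
        using coset_conj_endpoint[of "inv\<^bsub>P\<^esub> \<alpha>" "inv\<^bsub>P\<^esub> \<beta>"] P c \<alpha>(1)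
        by (simp del: P.inv_inv coset.hom_inv)
      moreover have "inv\<^bsub>P\<^esub> \<alpha> \<otimes>\<^bsub>P\<^esub> inv\<^bsub>P\<^esub> \<beta> \<otimes>\<^bsub>P\<^esub> inv\<^bsub>P\<^esub> (inv\<^bsub>P\<^esub> \<alpha>) \<otimes>\<^bsub>P\<^esub> inv\<^bsub>P\<^esub> \<alpha> = inv\<^bsub>P\<^esub> (\<beta> \<otimes>\<^bsub>P\<^esub> \<alpha>)"
        using P \<alpha>(1) by (simp add: P.m_assoc P.inv_mult_group)
      ultimately have "coset (inv\<^bsub>P\<^esub> (\<beta> \<otimes>\<^bsub>P\<^esub> \<alpha>)) \<in> W" by (simp only:)
      then show ?thesis using coset.hom_inv[of "\<beta> \<otimes>\<^bsub>P\<^esub> \<alpha>"] P \<alpha>(1) by (metis P.m_closed)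
    qed
    then have "sheet ?V \<alpha> \<subseteq> {x \<in> topspace T. inv\<^bsub>Q\<^esub> x \<in> W}"
      using sheet_subset[OF \<alpha>(1), of ?V] by (auto simp: topspace_T sheet_def)
    then show "\<exists>V. openin X V \<and> \<one> \<in> V \<and> sheet V \<alpha> \<subseteq> {x \<in> topspace T. inv\<^bsub>Q\<^esub> x \<in> W}"
      using V V1 by blast
  qed (auto simp: topspace_T)
qed (auto simp: topspace_T)

lemma topological_group_Q: "topological_group Q T"
  unfolding topological_group_def
  using group_Q topspace_T continuous_mult_Q continuous_inv_Q by blast

definition proj :: "(real \<Rightarrow> 'a) set \<Rightarrow> 'a" where
  "proj A = the_elem (endpoint ` A)"

lemma proj_coset:
  assumes \<alpha>: "\<alpha> \<in> carrier P"
  shows "proj (coset \<alpha>) = \<alpha> 1"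
proof -
  have "endpoint \<gamma> = \<alpha> 1" if \<gamma>: "\<gamma> \<in> coset \<alpha>" for \<gamma>
  proof -
    from \<gamma> obtain \<nu> where \<nu>: "\<nu> \<in> N" "\<gamma> = \<nu> \<otimes>\<^bsub>P\<^esub> \<alpha>" by (auto simp: coset_def r_coset_def)
    then have "\<nu> 1 = \<one>" using N_loops by (auto simp: loops_iff_end)
    then show ?thesis using path_in_carrier[OF \<alpha>, of 1] by (simp add: \<nu>(2) endpoint_def path_at)
  qed
  moreover have "\<alpha> \<in> coset \<alpha>"
    unfolding coset_def by (rule P.rcos_self[OF \<alpha> N.subgroup_axioms])
  ultimately have "endpoint ` coset \<alpha> = {\<alpha> 1}" by force
  then show ?thesis by (simp add: proj_def)
qed

lemma proj_hom: "proj \<in> hom Q G"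
proof (rule homI)
  fix x assume "x \<in> carrier Q"
  then show "proj x \<in> carrier G"
    by (auto simp: carrier_Q proj_coset path_in_carrier)
next
  fix x y assume "x \<in> carrier Q" "y \<in> carrier Q"
  then obtain \<alpha> \<beta> where *: "\<alpha> \<in> carrier P" "x = coset \<alpha>" "\<beta> \<in> carrier P" "y = coset \<beta>"
    by (auto simp: carrier_Q)
  then have "proj (coset (\<alpha> \<otimes>\<^bsub>P\<^esub> \<beta>)) = proj x \<otimes> proj y"
    by (simp only: proj_coset P.m_closed path_mult_at) (simp add: path_at)
  then show "proj (x \<otimes>\<^bsub>Q\<^esub> y) = proj x \<otimes> proj y" using * by simp
qed

lemma sheet_endpoints:
  assumes "\<alpha> \<in> carrier P" "x \<in> sheet U \<alpha>"
  obtains \<beta> where "\<beta> \<in> small U" "\<beta> \<in> carrier P" "\<beta> 1 \<in> U" "x = coset (\<beta> \<otimes>\<^bsub>P\<^esub> \<alpha>)" "proj x = \<beta> 1 \<otimes> \<alpha> 1"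
proof -
  from assms(2) obtain \<beta> where \<beta>: "\<beta> \<in> small U" "x = coset (\<beta> \<otimes>\<^bsub>P\<^esub> \<alpha>)" by (auto simp: sheet_def)
  have P: "\<beta> \<in> carrier P" "\<beta> 1 \<in> U" using \<beta>(1) by (auto simp: small_def)
  have "proj (coset (\<beta> \<otimes>\<^bsub>P\<^esub> \<alpha>)) = \<beta> 1 \<otimes> \<alpha> 1"
    using proj_coset[of "\<beta> \<otimes>\<^bsub>P\<^esub> \<alpha>"] assms(1) P(1) by (simp del: coset.hom_mult add: path_at)
  then show ?thesis using that[OF \<beta>(1) P \<beta>(2)] \<beta>(2) by simp
qed

lemma continuous_proj: "continuous_map T X proj"
proof (unfold continuous_map_def, intro conjI allI impI)
  show "proj \<in> topspace T \<rightarrow> topspace X" using hom_in_carrier[OF proj_hom] by (simp add: topspace_T)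
  fix U assume U: "openin X U"
  show "openin T {x \<in> topspace T. proj x \<in> U}"
    unfolding openin_T cover_open_def
  proof (intro conjI ballI impI)
    fix \<alpha> assume \<alpha>: "\<alpha> \<in> carrier P" "coset \<alpha> \<in> {x \<in> topspace T. proj x \<in> U}"
    have a: "\<alpha> 1 \<in> carrier G" using path_in_carrier[OF \<alpha>(1), of 1] by simp
    let ?V = "{x \<in> carrier G. x \<otimes> \<alpha> 1 \<in> U}"
    have "sheet ?V \<alpha> \<subseteq> {x \<in> topspace T. proj x \<in> U}"
    proof
      fix x assume x: "x \<in> sheet ?V \<alpha>"
      obtain \<beta> where "\<beta> 1 \<in> ?V" "proj x = \<beta> 1 \<otimes> \<alpha> 1"
        by (rule sheet_endpoints[OF \<alpha>(1) x]) simp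
      then show "x \<in> {x \<in> topspace T. proj x \<in> U}"
        using x sheet_subset[OF \<alpha>(1), of ?V] by (auto simp: topspace_T)
    qed
    moreover have "openin X ?V" "\<one> \<in> ?V"
      using open_mult_vimage[OF U a] \<alpha> a by (auto simp: proj_coset)
    ultimately show "\<exists>V. openin X V \<and> \<one> \<in> V \<and> sheet V \<alpha> \<subseteq> {x \<in> topspace T. proj x \<in> U}" by blast
  qed (auto simp: topspace_T)
qed

text \<open>
  Local path connectedness enters here: the endpoints of small paths fill a neighbourhood.
\<close>

lemma open_map_proj: "open_map T X proj"
  unfolding open_map_def
proof (intro allI impI)
  fix W assume W: "openin T W"
  show "openin X (proj ` W)"
  proof (rule openin_subopen[THEN iffD2], rule ballI)
    fix y assume "y \<in> proj ` W"
    then obtain x where x: "x \<in> W" "y = proj x" by blast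
    then have "x \<in> carrier Q" using openin_subset[OF W] by (auto simp: topspace_T)
    then obtain \<alpha> where \<alpha>: "\<alpha> \<in> carrier P" "x = coset \<alpha>" by (auto simp: carrier_Q)
    have y: "y = \<alpha> 1" using x \<alpha> by (simp add: proj_coset)
    have a: "\<alpha> 1 \<in> carrier G" using path_in_carrier[OF \<alpha>(1), of 1] by simp
    obtain U where U: "openin X U" "\<one> \<in> U" "sheet U \<alpha> \<subseteq> W"
      using openin_T_sheetD[OF W \<alpha>(1)] x \<alpha> by blast
    obtain V where V: "openin X V" "\<one> \<in> V" "V \<subseteq> U" "\<forall>w\<in>V. \<exists>\<beta>\<in>small V. \<beta> 1 = w"
      by (rule small_path_nbhd[OF locally_path_connected U(1,2)])
    let ?S = "{z \<in> carrier G. z \<otimes> inv (\<alpha> 1) \<in> V}"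
    have "openin X ?S" by (rule open_mult_vimage[OF V(1)]) (use a in simp)
    moreover have "y \<in> ?S" using a V(2) y by simp
    moreover have "?S \<subseteq> proj ` W"
    proof
      fix z assume z: "z \<in> ?S"
      then obtain \<beta> where \<beta>: "\<beta> \<in> small V" "\<beta> 1 = z \<otimes> inv (\<alpha> 1)" using V(4) by blast
      have "\<beta> \<in> carrier P" using \<beta>(1) by (rule small_carrier)
      then have "proj (coset (\<beta> \<otimes>\<^bsub>P\<^esub> \<alpha>)) = z"
        using proj_coset[of "\<beta> \<otimes>\<^bsub>P\<^esub> \<alpha>"] \<alpha>(1) \<beta>(2) z a by (simp del: coset.hom_mult add: path_at m_assoc)
      moreover have "coset (\<beta> \<otimes>\<^bsub>P\<^esub> \<alpha>) \<in> W"
        using \<beta>(1) V(3) U(3) small_mono[of V U] by (auto simp: sheet_def)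
      ultimately show "z \<in> proj ` W" by (metis image_eqI)
    qed
    ultimately show "\<exists>S. openin X S \<and> y \<in> S \<and> S \<subseteq> proj ` W" by blast
  qed
qed

lemma proj_surj: "proj ` carrier Q = carrier G"
proof -
  have "proj ` carrier Q = endpoint ` carrier P"
    unfolding carrier_Q image_image by (rule image_cong) (simp_all add: proj_coset endpoint_def)
  then show ?thesis unfolding endpoint_surj[OF connected locally_path_connected] .
qed

text \<open>
  A neighbourhood of \<open>\<one>\<close> over which the covering is trivial: each of its points is reached by
  a path inside it, and the coset of that path depends on the point only.
\<close>

definition elementary :: "'a set \<Rightarrow> bool" where
  "elementary W \<longleftrightarrow> openin X W \<and> \<one> \<in> W \<and> (\<forall>w\<in>W. \<exists>\<beta>\<in>small W. \<beta> 1 = w) \<and>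
     (\<forall>\<beta>\<in>small W. \<forall>\<beta>'\<in>small W. \<beta> 1 = \<beta>' 1 \<longrightarrow> coset \<beta> = coset \<beta>')"

lemma ex_elementary: "\<exists>W. elementary W"
proof -
  obtain U where U: "openin X U" "\<one> \<in> U" "L \<inter> small U \<subseteq> N" using N_small by blast
  obtain V where V: "openin X V" "\<one> \<in> V" "\<forall>x\<in>V. inv x \<in> V" "\<forall>x\<in>V. \<forall>y\<in>V. x \<otimes> y \<in> U"
    by (rule one_nbhd_inv_mult[OF U(1,2)])
  obtain W where W: "openin X W" "\<one> \<in> W" "W \<subseteq> V" "\<forall>w\<in>W. \<exists>\<beta>\<in>small W. \<beta> 1 = w"
    by (rule small_path_nbhd[OF locally_path_connected V(1,2)])
  have "coset \<beta> = coset \<beta>'"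
    if \<beta>: "\<beta> \<in> small W" "\<beta>' \<in> small W" "\<beta> 1 = \<beta>' 1" for \<beta> \<beta>'
  proof -
    have P: "\<beta> \<in> carrier P" "\<beta>' \<in> carrier P" using \<beta> by (auto simp: small_def)
    have c: "\<beta>' 1 \<in> carrier G" using path_in_carrier[OF P(2), of 1] by simp
    have W_path: "\<beta> t \<in> W" "\<beta>' t \<in> W" if "t \<in> {0..1}" for t
      using \<beta>(1,2) that by (simp_all add: small_def)
    have "\<beta> t \<otimes> inv (\<beta>' t) \<in> U" if "t \<in> {0..1}" for t
      using W_path[OF that] W(3) V(3,4) by blast
    then have "\<beta> \<otimes>\<^bsub>P\<^esub> inv\<^bsub>P\<^esub> \<beta>' \<in> L \<inter> small U"
      using P c \<beta>(3) by (simp add: loops_iff_end small_def path_at)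
    then show ?thesis using U(3) P coset_eq_iff by blast
  qed
  then have "elementary W" using W unfolding elementary_def by blast
  then show ?thesis ..
qed

definition translate :: "'a set \<Rightarrow> 'a \<Rightarrow> 'a set" where
  "translate W g = {x \<in> carrier G. x \<otimes> inv g \<in> W}"

lemma openin_translate: "openin X W \<Longrightarrow> g \<in> carrier G \<Longrightarrow> openin X (translate W g)"
  unfolding translate_def by (simp add: open_mult_vimage)

lemma proj_sheet:
  assumes W: "elementary W" and \<alpha>: "\<alpha> \<in> carrier P"
  shows "proj ` sheet W \<alpha> = translate W (\<alpha> 1)"
proof
  have a: "\<alpha> 1 \<in> carrier G" using path_in_carrier[OF \<alpha>, of 1] by simp
  have WG: "W \<subseteq> carrier G" using W openin_subset[of X W] by (simp add: elementary_def)
  show "proj ` sheet W \<alpha> \<subseteq> translate W (\<alpha> 1)"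
  proof
    fix y assume "y \<in> proj ` sheet W \<alpha>"
    then obtain x where x: "x \<in> sheet W \<alpha>" "y = proj x" by blast
    obtain \<beta> where \<beta>: "\<beta> 1 \<in> W" "proj x = \<beta> 1 \<otimes> \<alpha> 1"
      by (rule sheet_endpoints[OF \<alpha> x(1)]) simp
    then have "\<beta> 1 \<in> carrier G" using WG by blast
    then show "y \<in> translate W (\<alpha> 1)"
      using a \<beta> x(2) by (simp add: translate_def m_assoc)
  qed
  show "translate W (\<alpha> 1) \<subseteq> proj ` sheet W \<alpha>"
  proof
    fix z assume z: "z \<in> translate W (\<alpha> 1)"
    then obtain \<beta> where \<beta>: "\<beta> \<in> small W" "\<beta> 1 = z \<otimes> inv (\<alpha> 1)"
      using W unfolding elementary_def translate_def by blast
    have "proj (coset (\<beta> \<otimes>\<^bsub>P\<^esub> \<alpha>)) = z"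
      using proj_coset[of "\<beta> \<otimes>\<^bsub>P\<^esub> \<alpha>"] \<alpha> \<beta>(2) z a small_carrier[OF \<beta>(1)]
      by (simp del: coset.hom_mult add: path_at m_assoc translate_def)
    moreover have "coset (\<beta> \<otimes>\<^bsub>P\<^esub> \<alpha>) \<in> sheet W \<alpha>" using \<beta>(1) unfolding sheet_def by (rule imageI)
    ultimately show "z \<in> proj ` sheet W \<alpha>" by (metis image_eqI)
  qed
qed

text \<open>
  Two points over the same point of \<open>G\<close>, on sheets whose centres lie over the same point, arise
  from the centres by one and the same displacement. This gives disjointness of the sheets and
  injectivity of the projection on each of them.
\<close>

lemma sheets_meet:
  assumes W: "elementary W" and \<alpha>: "\<alpha> \<in> carrier P" "\<alpha>' \<in> carrier P" "\<alpha> 1 = \<alpha>' 1"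
    and x: "x \<in> sheet W \<alpha>" "y \<in> sheet W \<alpha>'" "proj x = proj y"
  obtains \<beta> \<beta>' where "\<beta> \<in> carrier P" "\<beta>' \<in> carrier P" "coset \<beta> = coset \<beta>'"
    "x = coset \<beta> \<otimes>\<^bsub>Q\<^esub> coset \<alpha>" "y = coset \<beta>' \<otimes>\<^bsub>Q\<^esub> coset \<alpha>'"
proof -
  have WG: "W \<subseteq> carrier G" using W openin_subset[of X W] by (simp add: elementary_def)
  have a: "\<alpha>' 1 \<in> carrier G" using path_in_carrier[OF \<alpha>(2), of 1] by simp
  obtain \<beta> where \<beta>: "\<beta> \<in> small W" "\<beta> \<in> carrier P" "\<beta> 1 \<in> W" "x = coset (\<beta> \<otimes>\<^bsub>P\<^esub> \<alpha>)" "proj x = \<beta> 1 \<otimes> \<alpha> 1"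
    by (rule sheet_endpoints[OF \<alpha>(1) x(1)])
  obtain \<beta>' where \<beta>': "\<beta>' \<in> small W" "\<beta>' \<in> carrier P" "\<beta>' 1 \<in> W" "y = coset (\<beta>' \<otimes>\<^bsub>P\<^esub> \<alpha>')" "proj y = \<beta>' 1 \<otimes> \<alpha>' 1"
    by (rule sheet_endpoints[OF \<alpha>(2) x(2)])
  have "\<beta> 1 \<in> carrier G" "\<beta>' 1 \<in> carrier G" using \<beta>(3) \<beta>'(3) WG by auto
  moreover have "\<beta> 1 \<otimes> \<alpha>' 1 = \<beta>' 1 \<otimes> \<alpha>' 1" using \<beta>(5) \<beta>'(5) x(3) \<alpha>(3) by simp
  ultimately have "\<beta> 1 = \<beta>' 1" using a by simp
  then have "coset \<beta> = coset \<beta>'" using W \<beta>(1) \<beta>'(1) unfolding elementary_def by blast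
  moreover have "x = coset \<beta> \<otimes>\<^bsub>Q\<^esub> coset \<alpha>" "y = coset \<beta>' \<otimes>\<^bsub>Q\<^esub> coset \<alpha>'"
    using \<beta> \<beta>' \<alpha> by simp_all
  ultimately show ?thesis using that \<beta>(2) \<beta>'(2) by blast
qed

lemma sheets_disjoint:
  assumes W: "elementary W" and \<alpha>: "\<alpha> \<in> carrier P" "\<alpha>' \<in> carrier P" "\<alpha> 1 = \<alpha>' 1"
    and x: "x \<in> sheet W \<alpha>" "x \<in> sheet W \<alpha>'"
  shows "sheet W \<alpha> = sheet W \<alpha>'"
proof -
  obtain \<beta> \<beta>' where "\<beta> \<in> carrier P" "\<beta>' \<in> carrier P" "coset \<beta> = coset \<beta>'"
    "x = coset \<beta> \<otimes>\<^bsub>Q\<^esub> coset \<alpha>" "x = coset \<beta>' \<otimes>\<^bsub>Q\<^esub> coset \<alpha>'"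
    by (rule sheets_meet[OF W \<alpha> x refl])
  then have "coset \<alpha> = coset \<alpha>'" using \<alpha> by (metis Q.Units_eq Q.Units_l_cancel coset.hom_closed)
  then show ?thesis using sheet_coset_cong \<alpha> by blast
qed

lemma homeomorphic_map_sheet:
  assumes W: "elementary W" and \<alpha>: "\<alpha> \<in> carrier P"
  shows "homeomorphic_map (subtopology T (sheet W \<alpha>)) (subtopology X (translate W (\<alpha> 1))) proj"
proof (rule bijective_open_imp_homeomorphic_map)
  have oW: "openin X W" using W by (simp add: elementary_def)
  have a: "\<alpha> 1 \<in> carrier G" using path_in_carrier[OF \<alpha>, of 1] by simp
  have oS: "openin T (sheet W \<alpha>)" by (rule openin_sheet[OF oW \<alpha>])
  have oT: "openin X (translate W (\<alpha> 1))" by (rule openin_translate[OF oW a])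
  have top: "topspace (subtopology T (sheet W \<alpha>)) = sheet W \<alpha>"
    using openin_subset[OF oS] by auto
  show "continuous_map (subtopology T (sheet W \<alpha>)) (subtopology X (translate W (\<alpha> 1))) proj"
    unfolding continuous_map_in_subtopology top
    using continuous_map_from_subtopology[OF continuous_proj] proj_sheet[OF W \<alpha>] by blast
  show "open_map (subtopology T (sheet W \<alpha>)) (subtopology X (translate W (\<alpha> 1))) proj"
    using open_map_proj proj_sheet[OF W \<alpha>]
    unfolding open_map_def openin_open_subtopology[OF oS] openin_open_subtopology[OF oT] by blast
  have "topspace (subtopology X (translate W (\<alpha> 1))) = translate W (\<alpha> 1)"
    using openin_subset[OF oT] by auto
  then show "proj ` topspace (subtopology T (sheet W \<alpha>)) = topspace (subtopology X (translate W (\<alpha> 1)))"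
    unfolding top using proj_sheet[OF W \<alpha>] by simp
  show "inj_on proj (topspace (subtopology T (sheet W \<alpha>)))"
    unfolding top
  proof (rule inj_onI)
    fix x y assume xy: "x \<in> sheet W \<alpha>" "y \<in> sheet W \<alpha>" "proj x = proj y"
    obtain \<beta> \<beta>' where "coset \<beta> = coset \<beta>'" "x = coset \<beta> \<otimes>\<^bsub>Q\<^esub> coset \<alpha>" "y = coset \<beta>' \<otimes>\<^bsub>Q\<^esub> coset \<alpha>"
      by (rule sheets_meet[OF W \<alpha> \<alpha> refl xy])
    then show "x = y" by simp
  qed
qed

lemma covering_map_proj: "covering_map T X proj"
  unfolding covering_map_def
proof (intro conjI ballI)
  show "continuous_map T X proj" by (rule continuous_proj)
  show "proj ` topspace T = topspace X" using proj_surj by (simp add: topspace_T)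
  fix g assume "g \<in> topspace X"
  then have g: "g \<in> carrier G" by simp
  obtain W where W: "elementary W" using ex_elementary by blast
  then have oW: "openin X W" "\<one> \<in> W" by (simp_all add: elementary_def)
  let ?\<V> = "sheet W ` {\<alpha> \<in> carrier P. \<alpha> 1 = g}"
  show "\<exists>O'. g \<in> O' \<and> openin X O' \<and> (\<exists>\<V>. \<Union>\<V> = {x \<in> topspace T. proj x \<in> O'} \<and>
      (\<forall>V\<in>\<V>. openin T V) \<and> pairwise disjnt \<V> \<and>
      (\<forall>V\<in>\<V>. homeomorphic_map (subtopology T V) (subtopology X O') proj))"
  proof (rule exI[of _ "translate W g"], intro conjI exI[of _ ?\<V>])
    show "g \<in> translate W g" using g oW by (simp add: translate_def)
    show "openin X (translate W g)" by (rule openin_translate[OF oW(1) g])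
    show "\<forall>V\<in>?\<V>. openin T V" using openin_sheet[OF oW(1)] by blast
    show "\<forall>V\<in>?\<V>. homeomorphic_map (subtopology T V) (subtopology X (translate W g)) proj"
      using homeomorphic_map_sheet[OF W] by blast
    show "pairwise disjnt ?\<V>"
      using sheets_disjoint[OF W] unfolding pairwise_def disjnt_iff by blast
    show "\<Union>?\<V> = {x \<in> topspace T. proj x \<in> translate W g}"
    proof
      show "\<Union>?\<V> \<subseteq> {x \<in> topspace T. proj x \<in> translate W g}"
        using proj_sheet[OF W] sheet_subset unfolding topspace_T by blast
      show "{x \<in> topspace T. proj x \<in> translate W g} \<subseteq> \<Union>?\<V>"
      proof
        fix x assume x: "x \<in> {x \<in> topspace T. proj x \<in> translate W g}"
        then have "x \<in> coset ` carrier P" by (simp add: topspace_T carrier_Q)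
        then obtain \<gamma> where \<gamma>: "\<gamma> \<in> carrier P" "x = coset \<gamma>" by blast
        then have c: "\<gamma> 1 \<in> carrier G" "\<gamma> 1 \<otimes> inv g \<in> W" using x by (auto simp: proj_coset translate_def)
        obtain \<beta> where \<beta>: "\<beta> \<in> small W" "\<beta> 1 = \<gamma> 1 \<otimes> inv g" using W c(2) unfolding elementary_def by blast
        have \<beta>P: "\<beta> \<in> carrier P" using \<beta>(1) by (rule small_carrier)
        let ?\<alpha> = "inv\<^bsub>P\<^esub> \<beta> \<otimes>\<^bsub>P\<^esub> \<gamma>"
        have "?\<alpha> \<in> carrier P" using \<beta>P \<gamma> by simp
        moreover have "?\<alpha> 1 = g" using \<beta>P \<beta>(2) c(1) g by (simp add: path_at inv_mult_group m_assoc)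
        moreover have "x \<in> sheet W ?\<alpha>"
        proof -
          have "\<beta> \<otimes>\<^bsub>P\<^esub> ?\<alpha> = \<gamma>" using \<beta>P \<gamma>(1) by (simp add: P.m_assoc[symmetric])
          then show ?thesis using \<beta>(1) unfolding sheet_def \<gamma>(2) by (metis image_eqI)
        qed
        ultimately show "x \<in> \<Union>?\<V>" by blast
      qed
    qed
  qed
qed

text \<open>
  A continuous family of paths traces a continuous path in the covering. Applied to the family of
  initial pieces of \<open>\<alpha>\<close>, this lifts \<open>\<alpha>\<close> to a path that ends at the coset of \<open>\<alpha>\<close> itself.
\<close>

lemma continuous_coset_slices:
  assumes h: "continuous_map (prod_topology unit_interval unit_interval) X h"
    and h0: "\<And>s. s \<in> {0..1} \<Longrightarrow> h (s, 0) = \<one>"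
  shows "continuous_map unit_interval T (\<lambda>s. coset (slice h s))"
proof (unfold continuous_map_def, intro conjI allI impI)
  have P: "slice h s \<in> carrier P" if "s \<in> {0..1}" for s
    by (rule slice_in_path_group[OF h that h0[OF that]])
  show "(\<lambda>s. coset (slice h s)) \<in> topspace unit_interval \<rightarrow> topspace T"
    using P by (auto simp: topspace_T)
  fix W assume W: "openin T W"
  show "openin unit_interval {s \<in> topspace unit_interval. coset (slice h s) \<in> W}"
  proof (rule openin_subopen[THEN iffD2], rule ballI)
    fix s0 assume "s0 \<in> {s \<in> topspace unit_interval. coset (slice h s) \<in> W}"
    then have s0: "s0 \<in> {0..1}" "coset (slice h s0) \<in> W" by auto
    obtain U where U: "openin X U" "\<one> \<in> U" "sheet U (slice h s0) \<subseteq> W"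
      using openin_T_sheetD[OF W P[OF s0(1)] s0(2)] by blast
    obtain V where V: "openin unit_interval V" "s0 \<in> V"
        "\<And>s t. s \<in> V \<Longrightarrow> t \<in> {0..1} \<Longrightarrow> h (s, t) \<otimes> inv h (s0, t) \<in> U"
      using nearby_slices[OF h U(1,2), of s0] s0(1) by auto
    have VI: "V \<subseteq> {0..1}" using openin_subset[OF V(1)] by simp
    have "coset (slice h s) \<in> W" if s: "s \<in> V" for s
    proof -
      let ?d = "slice h s \<otimes>\<^bsub>P\<^esub> inv\<^bsub>P\<^esub> slice h s0"
      have P2: "slice h s \<in> carrier P" "slice h s0 \<in> carrier P" using P s s0 VI by auto
      have "?d \<in> small U"
        unfolding small_def using P2 V(3)[OF s] by (auto simp: path_at) (auto simp: slice_def)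
      moreover have "?d \<otimes>\<^bsub>P\<^esub> slice h s0 = slice h s" using P2 by (simp add: P.m_assoc)
      ultimately have "coset (slice h s) \<in> sheet U (slice h s0)" unfolding sheet_def by (metis image_eqI)
      then show ?thesis using U(3) by blast
    qed
    then show "\<exists>V. openin unit_interval V \<and> s0 \<in> V \<and> V \<subseteq> {s \<in> topspace unit_interval. coset (slice h s) \<in> W}"
      using V(1,2) VI by (intro exI[of _ V]) auto
  qed
qed

lemma lift_to_cover:
  assumes \<alpha>: "\<alpha> \<in> carrier P"
  obtains \<eta> where "\<eta> \<in> paths_from T \<one>\<^bsub>Q\<^esub>" "\<And>s. s \<in> {0..1} \<Longrightarrow> proj (\<eta> s) = \<alpha> s" "\<eta> 1 = coset \<alpha>"
proof
  let ?\<eta> = "restrict (\<lambda>s. coset (slice (stretch \<alpha>) s)) {0..1}"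
  have c: "continuous_map unit_interval T (\<lambda>s. coset (slice (stretch \<alpha>) s))"
    by (rule continuous_coset_slices) (use stretch[OF \<alpha>] in auto)
  show "?\<eta> \<in> paths_from T \<one>\<^bsub>Q\<^esub>"
    by (rule paths_from_restrictI[OF c]) (use stretch[OF \<alpha>] in simp)
  show "proj (?\<eta> s) = \<alpha> s" if "s \<in> {0..1}" for s
    using that proj_coset[OF slice_in_path_group[OF stretch(1)[OF \<alpha>] that stretch(2)[OF \<alpha>]]] stretch(5)[OF \<alpha>]
    by simp
  show "?\<eta> 1 = coset \<alpha>" using stretch(4)[OF \<alpha>] by simp
qed

lemma connected_T: "connected_space T"
  unfolding connected_space_subconnected
proof (intro ballI)
  have *: "\<exists>S. connectedin T S \<and> \<one>\<^bsub>Q\<^esub> \<in> S \<and> x \<in> S" if "x \<in> topspace T" for x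
  proof -
    have "x \<in> coset ` carrier P" using that unfolding topspace_T carrier_Q .
    then obtain \<alpha> where \<alpha>: "\<alpha> \<in> carrier P" "x = coset \<alpha>" by blast
    obtain \<eta> where \<eta>: "\<eta> \<in> paths_from T \<one>\<^bsub>Q\<^esub>" "\<eta> 1 = coset \<alpha>"
      by (rule lift_to_cover[OF \<alpha>(1)]) simp
    have "connectedin unit_interval {0..1}"
      using connected_unit_interval by (simp add: connectedin_def subtopology_subtopology)
    moreover have "continuous_map unit_interval T \<eta>" using \<eta>(1) by (simp add: paths_from_def)
    ultimately have "connectedin T (\<eta> ` {0..1})" by (rule connectedin_continuous_map_image[rotated])
    moreover have "\<one>\<^bsub>Q\<^esub> \<in> \<eta> ` {0..1}"
      using \<eta>(1) by (intro image_eqI[of _ _ 0]) (simp_all add: paths_from_def)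
    moreover have "x \<in> \<eta> ` {0..1}"
      using \<eta>(2) \<alpha>(2) by (intro image_eqI[of _ _ 1]) simp_all
    ultimately show ?thesis by blast
  qed
  fix x y assume "x \<in> topspace T" "y \<in> topspace T"
  then obtain A B where "connectedin T A" "\<one>\<^bsub>Q\<^esub> \<in> A" "x \<in> A" "connectedin T B" "\<one>\<^bsub>Q\<^esub> \<in> B" "y \<in> B"
    using * by meson
  then show "\<exists>S. connectedin T S \<and> x \<in> S \<and> y \<in> S"
    using connectedin_Un[of T A B] by (intro exI[of _ "A \<union> B"]) auto
qed

lemma connected_covering_group_Q: "connected_covering_group G X (Q, T, proj)"
  unfolding connected_covering_group_def
  using topological_group_Q proj_hom covering_map_proj connected_T by simp

end

section \<open>Lifting paths to a covering group\<close>

locale covering_group = base: top_group G X + cover: top_group K Y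
  for G :: "'a monoid" and X :: "'a topology" and K :: "'h monoid" and Y :: "'h topology" +
  fixes p :: "'h \<Rightarrow> 'a"
  assumes base_connected: "connected_space X"
    and base_locally_path_connected: "locally_path_connected_space X"
    and cover_connected: "connected_space Y"
    and p_hom: "p \<in> hom K G"
    and covering: "covering_map Y X p"
begin

sublocale p: group_hom K G p
  by unfold_locales (rule p_hom)

lemma continuous_p: "continuous_map Y X p"
  using covering by (simp add: covering_map_def)

text \<open>
  The sheet through \<open>\<one>\<close> over an evenly covered neighbourhood of \<open>\<one>\<close>, with the inverse of the
  projection on it. By homogeneity this one sheet governs lifting
  near every point: paths are lifted after translation to \<open>\<one>\<close>.
\<close>

definition section_on :: "'a set \<Rightarrow> 'h set \<Rightarrow> ('a \<Rightarrow> 'h) \<Rightarrow> bool" where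
  "section_on U W \<sigma> \<longleftrightarrow> openin X U \<and> \<one>\<^bsub>G\<^esub> \<in> U \<and> openin Y W \<and> \<one>\<^bsub>K\<^esub> \<in> W \<and>
     homeomorphic_maps (subtopology Y W) (subtopology X U) p \<sigma>"

lemma ex_section: "\<exists>U W \<sigma>. section_on U W \<sigma>"
proof -
  have "\<one>\<^bsub>G\<^esub> \<in> topspace X" by simp
  then obtain U \<V> where U: "\<one>\<^bsub>G\<^esub> \<in> U" "openin X U" and \<V>: "\<Union>\<V> = {x \<in> topspace Y. p x \<in> U}"
      "\<forall>V\<in>\<V>. openin Y V" "\<forall>V\<in>\<V>. homeomorphic_map (subtopology Y V) (subtopology X U) p"
    using covering unfolding covering_map_def by blast
  have "\<one>\<^bsub>K\<^esub> \<in> \<Union>\<V>" using \<V>(1) U(1) by simp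
  then obtain W where "W \<in> \<V>" "\<one>\<^bsub>K\<^esub> \<in> W" by blast
  then show ?thesis using U \<V>(2,3) homeomorphic_map_maps unfolding section_on_def by meson
qed

lemma section_onD:
  assumes "section_on U W \<sigma>"
  shows "openin X U" "\<one>\<^bsub>G\<^esub> \<in> U" "openin Y W" "\<one>\<^bsub>K\<^esub> \<in> W" "W \<subseteq> carrier K"
    "continuous_map (subtopology X U) Y \<sigma>"
    "\<And>y. y \<in> W \<Longrightarrow> p y \<in> U" "\<And>y. y \<in> W \<Longrightarrow> \<sigma> (p y) = y"
    "\<And>x. x \<in> U \<Longrightarrow> \<sigma> x \<in> W" "\<And>x. x \<in> U \<Longrightarrow> p (\<sigma> x) = x" "\<sigma> \<one>\<^bsub>G\<^esub> = \<one>\<^bsub>K\<^esub>"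
proof -
  have h: "homeomorphic_maps (subtopology Y W) (subtopology X U) p \<sigma>"
    and s: "openin X U" "\<one>\<^bsub>G\<^esub> \<in> U" "openin Y W" "\<one>\<^bsub>K\<^esub> \<in> W"
    using assms by (simp_all add: section_on_def)
  have top: "topspace (subtopology Y W) = W" "topspace (subtopology X U) = U"
    using openin_subset[OF s(1)] openin_subset[OF s(3)] by auto
  have c: "continuous_map (subtopology Y W) (subtopology X U) p"
    "continuous_map (subtopology X U) (subtopology Y W) \<sigma>"
    and inv: "\<And>y. y \<in> W \<Longrightarrow> \<sigma> (p y) = y" "\<And>x. x \<in> U \<Longrightarrow> p (\<sigma> x) = x"
    using h unfolding homeomorphic_maps_def top by blast+
  show "openin X U" "\<one>\<^bsub>G\<^esub> \<in> U" "openin Y W" "\<one>\<^bsub>K\<^esub> \<in> W" by fact+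
  show "W \<subseteq> carrier K" using openin_subset[OF s(3)] by simp
  show "continuous_map (subtopology X U) Y \<sigma>" using c(2) by (rule continuous_map_into_fulltopology)
  show "p y \<in> U" if "y \<in> W" for y
    using continuous_map_image_subset_topspace[OF c(1)] that unfolding top by blast
  show "\<sigma> x \<in> W" if "x \<in> U" for x
    using continuous_map_image_subset_topspace[OF c(2)] that unfolding top by blast
  show "\<sigma> (p y) = y" if "y \<in> W" for y using inv(1) that .
  show "p (\<sigma> x) = x" if "x \<in> U" for x using inv(2) that .
  show "\<sigma> \<one>\<^bsub>G\<^esub> = \<one>\<^bsub>K\<^esub>" using inv(1)[OF s(4)] by simp
qed

definition push :: "(real \<Rightarrow> 'h) \<Rightarrow> real \<Rightarrow> 'a" where
  "push \<gamma> = restrict (p \<circ> \<gamma>) {0..1}"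

lemma push_at: "t \<in> {0..1} \<Longrightarrow> push \<gamma> t = p (\<gamma> t)"
  by (simp add: push_def)

lemma push_closed:
  assumes "\<gamma> \<in> carrier cover.P"
  shows "push \<gamma> \<in> carrier base.P"
  unfolding push_def
  by (rule base.restrict_in_path_group)
     (use assms continuous_map_compose[OF cover.path_continuous[OF assms] continuous_p]
       in \<open>simp_all add: cover.path_at_0\<close>)

lemma push_hom: "push \<in> hom cover.P base.P"
proof (rule homI)
  fix \<gamma> \<delta> assume P: "\<gamma> \<in> carrier cover.P" "\<delta> \<in> carrier cover.P"
  show "push (\<gamma> \<otimes>\<^bsub>cover.P\<^esub> \<delta>) = push \<gamma> \<otimes>\<^bsub>base.P\<^esub> push \<delta>"
    by (rule base.path_eqI)
       (use P in \<open>simp_all add: push_closed push_at base.path_at cover.path_at cover.path_in_carrier\<close>)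
qed (rule push_closed)

sublocale push: group_hom cover.P base.P push
  by unfold_locales (rule push_hom)

text \<open>
  Uniqueness of lifts. The kernel of \<open>p\<close> meets \<open>W\<close> only in \<open>\<one>\<close>, so a path in the kernel is
  locally constant.
\<close>

lemma push_eq_one:
  assumes \<gamma>: "\<gamma> \<in> carrier cover.P" and "push \<gamma> = \<one>\<^bsub>base.P\<^esub>"
  shows "\<gamma> = \<one>\<^bsub>cover.P\<^esub>"
proof (rule cover.path_eqI[OF \<gamma>])
  have ker: "p (\<gamma> t) = \<one>\<^bsub>G\<^esub>" if "t \<in> {0..1}" for t
    using assms(2) base.path_one_at[OF that] push_at[OF that, of \<gamma>] by simp
  obtain U W \<sigma> where s: "section_on U W \<sigma>" using ex_section by blast
  note S = section_onD[OF s]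
  fix t :: real assume t: "t \<in> {0..1}"
  have "\<gamma> t = \<one>\<^bsub>K\<^esub>"
  proof (rule locally_constant_unit_interval[where R = "\<lambda>t. \<gamma> t = \<one>\<^bsub>K\<^esub>", OF _ _ t])
    fix s :: real assume s: "s \<in> {0..1}"
    have gs: "\<gamma> s \<in> carrier K" using \<gamma> s by (rule cover.path_in_carrier)
    let ?V = "{t \<in> topspace unit_interval. \<gamma> t \<otimes>\<^bsub>K\<^esub> inv\<^bsub>K\<^esub> \<gamma> s \<in> W}"
    have "continuous_map unit_interval Y (\<lambda>t. \<gamma> t \<otimes>\<^bsub>K\<^esub> inv\<^bsub>K\<^esub> \<gamma> s)"
      using gs by (intro cover.cm_mult cover.path_continuous[OF \<gamma>] cover.cm_const) simp
    then have "openin unit_interval ?V" by (rule openin_continuous_map_preimage[OF _ S(3)])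
    moreover have "s \<in> ?V" using s gs S(4) by simp
    moreover have "\<forall>t\<in>?V. \<gamma> t = \<gamma> s"
    proof
      fix t assume t: "t \<in> ?V"
      have tI: "t \<in> {0..1}" and W: "\<gamma> t \<otimes>\<^bsub>K\<^esub> inv\<^bsub>K\<^esub> \<gamma> s \<in> W" using t by auto
      have gt: "\<gamma> t \<in> carrier K" using \<gamma> tI by (rule cover.path_in_carrier)
      have "p (\<gamma> t \<otimes>\<^bsub>K\<^esub> inv\<^bsub>K\<^esub> \<gamma> s) = \<one>\<^bsub>G\<^esub>" using gs gt ker[OF s] ker[OF tI] by simp
      then have "\<gamma> t \<otimes>\<^bsub>K\<^esub> inv\<^bsub>K\<^esub> \<gamma> s = \<one>\<^bsub>K\<^esub>" using S(8)[OF W] S(11) by simp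
      then have "\<gamma> t \<otimes>\<^bsub>K\<^esub> inv\<^bsub>K\<^esub> \<gamma> s \<otimes>\<^bsub>K\<^esub> \<gamma> s = \<gamma> s" using gs by simp
      then show "\<gamma> t = \<gamma> s" using gs gt by (simp add: cover.m_assoc)
    qed
    then have "\<forall>t\<in>?V. \<gamma> t = \<one>\<^bsub>K\<^esub> \<longleftrightarrow> \<gamma> s = \<one>\<^bsub>K\<^esub>" by metis
    ultimately show "\<exists>V. openin unit_interval V \<and> s \<in> V \<and> (\<forall>t\<in>V. \<gamma> t = \<one>\<^bsub>K\<^esub> \<longleftrightarrow> \<gamma> s = \<one>\<^bsub>K\<^esub>)"
      by blast
  qed (rule cover.path_at_0[OF \<gamma>])
  then show "\<gamma> t = \<one>\<^bsub>cover.P\<^esub> t" using t by (simp add: cover.path_at)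
qed simp

lemma push_inj: "inj_on push (carrier cover.P)"
  unfolding push.inj_on_one_iff using push_eq_one by blast

lemma small_lift:
  assumes s: "section_on U W \<sigma>" and \<beta>: "\<beta> \<in> base.small U"
  shows "restrict (\<sigma> \<circ> \<beta>) {0..1} \<in> carrier cover.P" "push (restrict (\<sigma> \<circ> \<beta>) {0..1}) = \<beta>"
proof -
  note S = section_onD[OF s]
  have \<beta>P: "\<beta> \<in> carrier base.P" and \<beta>U: "\<And>t. t \<in> {0..1} \<Longrightarrow> \<beta> t \<in> U"
    using \<beta> by (auto simp: base.small_def)
  have "continuous_map unit_interval (subtopology X U) \<beta>"
    using base.path_continuous[OF \<beta>P] \<beta>U by (simp add: continuous_map_in_subtopology Pi_iff)
  then have c: "continuous_map unit_interval Y (\<sigma> \<circ> \<beta>)" by (rule continuous_map_compose[OF _ S(6)])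
  show P: "restrict (\<sigma> \<circ> \<beta>) {0..1} \<in> carrier cover.P"
    by (rule cover.restrict_in_path_group[OF c]) (simp add: base.path_at_0[OF \<beta>P] S(11))
  show "push (restrict (\<sigma> \<circ> \<beta>) {0..1}) = \<beta>"
    by (rule base.path_eqI[OF push_closed[OF P] \<beta>P]) (simp add: push_at S(10) \<beta>U)
qed

text \<open>
  Existence of lifts. The liftable paths form a subgroup that contains all small paths, and each path
  is a deformation of the constant one through its initial pieces.
\<close>

lemma push_surj: "push ` carrier cover.P = carrier base.P"
proof
  show "push ` carrier cover.P \<subseteq> carrier base.P" using push_closed by blast
  obtain U W \<sigma> where s: "section_on U W \<sigma>" using ex_section by blast
  note S = section_onD[OF s]
  show "carrier base.P \<subseteq> push ` carrier cover.P"
  proof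
    fix \<alpha> assume \<alpha>: "\<alpha> \<in> carrier base.P"
    have "base.slice (base.stretch \<alpha>) 1 \<in> push ` carrier cover.P"
    proof (rule base.deform_into_subgroup[OF push.img_is_subgroup base.P.subgroup_self S(1,2)])
      show "carrier base.P \<inter> base.small U \<subseteq> push ` carrier cover.P"
      proof
        fix \<beta> assume "\<beta> \<in> carrier base.P \<inter> base.small U"
        then have "\<beta> \<in> base.small U" by blast
        then show "\<beta> \<in> push ` carrier cover.P"
          using small_lift[OF s] by (intro image_eqI[of _ push "restrict (\<sigma> \<circ> \<beta>) {0..1}"]) simp_all
      qed
      show "base.slice (base.stretch \<alpha>) s \<in> carrier base.P" if "s \<in> {0..1}" for s
        by (rule base.slice_in_path_group[OF base.stretch(1)[OF \<alpha>] that base.stretch(2)[OF \<alpha>]])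
      show "base.slice (base.stretch \<alpha>) 0 \<in> push ` carrier cover.P"
        unfolding base.stretch(3)[OF \<alpha>] by (intro image_eqI[of _ push "\<one>\<^bsub>cover.P\<^esub>"]) simp_all
    qed (rule base.stretch(1)[OF \<alpha>])
    then show "\<alpha> \<in> push ` carrier cover.P" by (simp add: base.stretch(4)[OF \<alpha>])
  qed
qed

definition closed_lifts :: "(real \<Rightarrow> 'a) set" where
  "closed_lifts = push ` cover.L"

lemma push_loops: "\<gamma> \<in> cover.L \<Longrightarrow> push \<gamma> \<in> base.L"
  by (simp add: cover.loops_iff_end base.loops_iff_end push_closed push_at)

lemma closed_lifts_subset: "closed_lifts \<subseteq> base.L"
  unfolding closed_lifts_def using push_loops by blast

lemma subgroup_closed_lifts: "subgroup closed_lifts base.P"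
  unfolding closed_lifts_def by (rule push.subgroup_img_is_subgroup[OF cover.subgroup_loops])

lemma closed_lifts_small:
  assumes s: "section_on U W \<sigma>"
  shows "base.L \<inter> base.small U \<subseteq> closed_lifts"
proof
  fix \<beta> assume \<beta>: "\<beta> \<in> base.L \<inter> base.small U"
  then have "\<beta> 1 = \<one>\<^bsub>G\<^esub>" by (simp add: base.loops_iff_end)
  then have "restrict (\<sigma> \<circ> \<beta>) {0..1} \<in> cover.L"
    using small_lift(1)[OF s, of \<beta>] section_onD(11)[OF s] \<beta> by (simp add: cover.loops_iff_end)
  moreover have "push (restrict (\<sigma> \<circ> \<beta>) {0..1}) = \<beta>" using small_lift(2)[OF s] \<beta> by blast
  ultimately show "\<beta> \<in> closed_lifts" unfolding closed_lifts_def by (metis image_eqI)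
qed

lemma closed_lifts_homotopy:
  assumes \<gamma>: "\<gamma> \<in> closed_lifts" and \<delta>: "\<delta> \<in> base.L" and eq: "base.cls \<gamma> = base.cls \<delta>"
  shows "\<delta> \<in> closed_lifts"
proof -
  have \<gamma>L: "\<gamma> \<in> base.L" using \<gamma> closed_lifts_subset by blast
  obtain U W \<sigma> where s: "section_on U W \<sigma>" using ex_section by blast
  have "(\<gamma>, \<delta>) \<in> loop_homotopy X \<one>\<^bsub>G\<^esub>" using base.cls_eq_iff[OF \<gamma>L \<delta>] eq by simp
  then obtain h where h: "continuous_map (prod_topology unit_interval unit_interval) X h"
    "\<And>s. s \<in> {0..1} \<Longrightarrow> h (s, 0) = \<one>\<^bsub>G\<^esub>" "\<And>s. s \<in> {0..1} \<Longrightarrow> h (s, 1) = \<one>\<^bsub>G\<^esub>"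
    "base.slice h 0 = \<gamma>" "base.slice h 1 = \<delta>"
    by (rule base.loop_homotopyE) blast
  have "base.slice h 1 \<in> closed_lifts"
  proof (rule base.deform_into_subgroup[OF subgroup_closed_lifts base.subgroup_loops
        section_onD(1,2)[OF s] closed_lifts_small[OF s] h(1)])
    show "base.slice h s \<in> base.L" if "s \<in> {0..1}" for s
      using base.slice_in_path_group[OF h(1) that h(2)[OF that]] h(3)[OF that]
      by (simp add: base.loops_iff_end base.slice_def)
    show "base.slice h 0 \<in> closed_lifts" using h(4) \<gamma> by simp
  qed
  then show ?thesis using h(5) by simp
qed

lemma cover_endpoint_in_loops_iff: "\<gamma> \<in> carrier cover.P \<Longrightarrow> push \<gamma> \<in> closed_lifts \<longleftrightarrow> \<gamma> 1 = \<one>\<^bsub>K\<^esub>"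
  unfolding closed_lifts_def
  using inj_on_image_mem_iff[OF push_inj _ cover.loops_subset] by (simp add: cover.loops_iff_end)

text \<open>
  The endpoint of the lift is the map that identifies \<open>K\<close> with a quotient of the path group of \<open>G\<close>.
\<close>

definition lift_end :: "(real \<Rightarrow> 'a) \<Rightarrow> 'h" where
  "lift_end \<alpha> = inv_into (carrier cover.P) push \<alpha> 1"

lemma lift_end_push: "\<gamma> \<in> carrier cover.P \<Longrightarrow> lift_end (push \<gamma>) = \<gamma> 1"
  by (simp add: lift_end_def inv_into_f_f[OF push_inj])

lemma obtain_lift:
  assumes "\<alpha> \<in> carrier base.P"
  obtains \<gamma> where "\<gamma> \<in> carrier cover.P" "\<alpha> = push \<gamma>"
  using assms push_surj by blast

lemma lift_end_hom: "lift_end \<in> hom base.P K"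
proof (rule homI)
  fix \<alpha> assume "\<alpha> \<in> carrier base.P"
  then obtain \<gamma> where \<gamma>: "\<gamma> \<in> carrier cover.P" "\<alpha> = push \<gamma>" by (rule obtain_lift)
  then show "lift_end \<alpha> \<in> carrier K" using cover.path_in_carrier[OF \<gamma>(1), of 1] by (simp add: lift_end_push)
next
  fix \<alpha> \<beta> assume "\<alpha> \<in> carrier base.P" "\<beta> \<in> carrier base.P"
  then obtain \<gamma> \<delta> where *: "\<gamma> \<in> carrier cover.P" "\<alpha> = push \<gamma>" "\<delta> \<in> carrier cover.P" "\<beta> = push \<delta>"
    using obtain_lift by metis
  then have "lift_end (push (\<gamma> \<otimes>\<^bsub>cover.P\<^esub> \<delta>)) = lift_end \<alpha> \<otimes>\<^bsub>K\<^esub> lift_end \<beta>"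
    by (simp del: push.hom_mult add: lift_end_push cover.path_at)
  then show "lift_end (\<alpha> \<otimes>\<^bsub>base.P\<^esub> \<beta>) = lift_end \<alpha> \<otimes>\<^bsub>K\<^esub> lift_end \<beta>" using * by simp
qed

sublocale lift_end: group_hom base.P K lift_end
  by unfold_locales (rule lift_end_hom)

lemma p_lift_end: "\<alpha> \<in> carrier base.P \<Longrightarrow> p (lift_end \<alpha>) = \<alpha> 1"
  by (erule obtain_lift) (simp add: lift_end_push push_at)

lemma kernel_lift_end: "kernel base.P K lift_end = closed_lifts"
proof -
  have "lift_end \<alpha> = \<one>\<^bsub>K\<^esub> \<longleftrightarrow> \<alpha> \<in> closed_lifts" if "\<alpha> \<in> carrier base.P" for \<alpha>
    using that by (rule obtain_lift) (simp add: lift_end_push cover_endpoint_in_loops_iff)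
  then show ?thesis
    using closed_lifts_subset base.loops_subset by (auto simp: kernel_def)
qed

lemma lift_end_small:
  assumes s: "section_on U W \<sigma>" and \<beta>: "\<beta> \<in> base.small U"
  shows "lift_end \<beta> = \<sigma> (\<beta> 1)"
  using lift_end_push[OF small_lift(1)[OF s \<beta>]] small_lift(2)[OF s \<beta>] by simp

text \<open>
  Lifts of small paths reach a whole neighbourhood of \<open>\<one>\<close> in \<open>K\<close>. This makes the induced map on
  the quotient open, and together with connectedness of \<open>K\<close> it makes it surjective.
\<close>

lemma small_lift_ends_nbhd:
  assumes U: "openin X U" "\<one>\<^bsub>G\<^esub> \<in> U"
  obtains B where "openin Y B" "\<one>\<^bsub>K\<^esub> \<in> B" "B \<subseteq> lift_end ` base.small U"
proof -
  obtain U' W \<sigma> where s: "section_on U' W \<sigma>" using ex_section by blast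
  note S = section_onD[OF s]
  have "openin X (U \<inter> U')" "\<one>\<^bsub>G\<^esub> \<in> U \<inter> U'" using U S(1,2) by auto
  then obtain V where V: "openin X V" "\<one>\<^bsub>G\<^esub> \<in> V" "V \<subseteq> U \<inter> U'" "\<forall>v\<in>V. \<exists>\<beta>\<in>base.small V. \<beta> 1 = v"
    by (rule base.small_path_nbhd[OF base_locally_path_connected])
  let ?B = "W \<inter> {y \<in> topspace Y. p y \<in> V}"
  have "openin Y ?B" by (intro openin_Int S(3) openin_continuous_map_preimage[OF continuous_p V(1)])
  moreover have "\<one>\<^bsub>K\<^esub> \<in> ?B" using S(4) V(2) by simp
  moreover have "?B \<subseteq> lift_end ` base.small U"
  proof
    fix y assume y: "y \<in> ?B"
    then obtain \<beta> where \<beta>: "\<beta> \<in> base.small V" "\<beta> 1 = p y" using V(4) by blast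
    have "\<beta> \<in> base.small U'" "\<beta> \<in> base.small U"
      using \<beta>(1) V(3) base.small_mono[of V U'] base.small_mono[of V U] by auto
    moreover from this have "lift_end \<beta> = y" using lift_end_small[OF s] \<beta>(2) S(8) y by simp
    ultimately show "y \<in> lift_end ` base.small U" by blast
  qed
  ultimately show ?thesis by (rule that)
qed

text \<open>
  The endpoints of lifts form a subgroup containing a neighbourhood of \<open>\<one>\<close> in the connected group \<open>K\<close>.
\<close>

lemma lift_end_surj: "lift_end ` carrier base.P = carrier K"
proof -
  have "openin X (carrier G)" using openin_topspace[of X] by simp
  then obtain B where B: "openin Y B" "\<one>\<^bsub>K\<^esub> \<in> B" "B \<subseteq> lift_end ` base.small (carrier G)"
    by (rule small_lift_ends_nbhd) simp
  have "B \<subseteq> lift_end ` carrier base.P" using B(3) by (auto simp: base.small_def)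
  then show ?thesis
    by (rule cover.open_subgroup_eq_carrier[OF cover_connected lift_end.img_is_subgroup B(1,2)])
qed

lemma loop_covering_closed_lifts: "loop_covering G X closed_lifts"
proof (intro loop_covering.intro loop_covering_axioms.intro base.top_group_axioms)
  show "closed_lifts \<lhd> base.P" using lift_end.normal_kernel by (simp add: kernel_lift_end)
  show "\<exists>U. openin X U \<and> \<one>\<^bsub>G\<^esub> \<in> U \<and> base.L \<inter> base.small U \<subseteq> closed_lifts"
    using ex_section closed_lifts_small section_onD(1,2) by meson
qed (use base_connected base_locally_path_connected closed_lifts_subset closed_lifts_homotopy in blast)+

sublocale model: loop_covering G X closed_lifts
  by (rule loop_covering_closed_lifts)

definition classify :: "(real \<Rightarrow> 'a) set \<Rightarrow> 'h" where
  "classify A = the_elem (lift_end ` A)"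

lemma classify_iso: "classify \<in> iso model.Q K"
  using lift_end.FactGroup_iso_set[OF lift_end_surj] unfolding kernel_lift_end classify_def .

lemma classify_coset:
  assumes \<alpha>: "\<alpha> \<in> carrier base.P"
  shows "classify (model.coset \<alpha>) = lift_end \<alpha>"
proof -
  have "lift_end \<gamma> = lift_end \<alpha>" if \<gamma>: "\<gamma> \<in> model.coset \<alpha>" for \<gamma>
  proof -
    from \<gamma> obtain \<nu> where \<nu>: "\<nu> \<in> closed_lifts" "\<gamma> = \<nu> \<otimes>\<^bsub>base.P\<^esub> \<alpha>" by (auto simp: model.coset_def r_coset_def)
    have "\<nu> \<in> kernel base.P K lift_end" unfolding kernel_lift_end by (rule \<nu>(1))
    then have "\<nu> \<in> carrier base.P" "lift_end \<nu> = \<one>\<^bsub>K\<^esub>" unfolding kernel_def by blast+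
    then show ?thesis using \<alpha> \<nu>(2) by simp
  qed
  moreover have "\<alpha> \<in> model.coset \<alpha>"
    unfolding model.coset_def by (rule base.P.rcos_self[OF \<alpha> subgroup_closed_lifts])
  ultimately have "lift_end ` model.coset \<alpha> = {lift_end \<alpha>}" by blast
  then show ?thesis by (simp add: classify_def)
qed

lemma p_classify:
  assumes "A \<in> carrier model.Q"
  shows "p (classify A) = model.proj A"
proof -
  obtain \<alpha> where "\<alpha> \<in> carrier base.P" "A = model.coset \<alpha>"
    using assms unfolding model.carrier_Q by blast
  then show ?thesis by (simp only: classify_coset p_lift_end model.proj_coset)
qed

lemma continuous_classify: "continuous_map model.T Y classify"
proof (unfold continuous_map_def, intro conjI allI impI)
  show "classify \<in> topspace model.T \<rightarrow> topspace Y"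
    using classify_iso unfolding iso_def hom_def model.topspace_T cover.topspace_eq by blast
  fix B assume B: "openin Y B"
  obtain U W \<sigma> where s: "section_on U W \<sigma>" using ex_section by blast
  note S = section_onD[OF s]
  show "openin model.T {A \<in> topspace model.T. classify A \<in> B}"
    unfolding model.openin_T model.cover_open_def
  proof (intro conjI ballI impI)
    fix \<alpha> assume \<alpha>: "\<alpha> \<in> carrier base.P" "model.coset \<alpha> \<in> {A \<in> topspace model.T. classify A \<in> B}"
    then have a: "lift_end \<alpha> \<in> carrier K" "lift_end \<alpha> \<in> B" by (simp_all add: classify_coset)
    \<comment> \<open>Lifts of paths in \<open>p ` ?C\<close> end in \<open>?C\<close>, as they are computed by the section \<open>\<sigma>\<close>.\<close>
    let ?C = "W \<inter> {y \<in> carrier K. y \<otimes>\<^bsub>K\<^esub> lift_end \<alpha> \<in> B}"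
    have C: "openin Y ?C" by (intro openin_Int S(3) cover.open_mult_vimage[OF B a(1)])
    have "homeomorphic_map (subtopology Y W) (subtopology X U) p"
      using s homeomorphic_map_maps unfolding section_on_def by blast
    then have "open_map (subtopology Y W) (subtopology X U) p" by (rule homeomorphic_imp_open_map)
    then have pC: "openin X (p ` ?C)"
      using C unfolding open_map_def openin_open_subtopology[OF S(1)] openin_open_subtopology[OF S(3)] by blast
    have one: "\<one>\<^bsub>G\<^esub> \<in> p ` ?C"
      by (rule image_eqI[of _ _ "\<one>\<^bsub>K\<^esub>"]) (use S(4) a in simp_all)
    have "model.sheet (p ` ?C) \<alpha> \<subseteq> {A \<in> topspace model.T. classify A \<in> B}"
    proof
      fix A assume A: "A \<in> model.sheet (p ` ?C) \<alpha>"
      then obtain \<beta> where \<beta>: "\<beta> \<in> base.small (p ` ?C)" "A = model.coset (\<beta> \<otimes>\<^bsub>base.P\<^esub> \<alpha>)"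
        by (auto simp only: model.sheet_def)
      have \<beta>P: "\<beta> \<in> carrier base.P" using \<beta>(1) by (rule model.small_carrier)
      have "p ` ?C \<subseteq> U" using S(7) by blast
      then have "\<beta> \<in> base.small U" using \<beta>(1) base.small_mono by blast
      then have le: "lift_end \<beta> = \<sigma> (\<beta> 1)" by (rule lift_end_small[OF s])
      have "\<beta> 1 \<in> p ` ?C" using \<beta>(1) by (simp add: base.small_def)
      then obtain y where y: "y \<in> ?C" "\<beta> 1 = p y" by blast
      then have "lift_end \<beta> = y" using le S(8) by simp
      moreover have "classify A = lift_end (\<beta> \<otimes>\<^bsub>base.P\<^esub> \<alpha>)"
        unfolding \<beta>(2) by (rule classify_coset) (use \<alpha>(1) \<beta>P in simp)
      ultimately have "classify A \<in> B" using y(1) \<alpha>(1) \<beta>P by simp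
      then show "A \<in> {A \<in> topspace model.T. classify A \<in> B}"
        using A model.sheet_subset[OF \<alpha>(1), of "p ` ?C"] by (auto simp: model.topspace_T)
    qed
    then show "\<exists>V. openin X V \<and> \<one>\<^bsub>G\<^esub> \<in> V \<and> model.sheet V \<alpha> \<subseteq> {A \<in> topspace model.T. classify A \<in> B}"
      using pC one by blast
  qed (auto simp: model.topspace_T)
qed

lemma open_map_classify: "open_map model.T Y classify"
  unfolding open_map_def
proof (intro allI impI)
  fix S assume S: "openin model.T S"
  show "openin Y (classify ` S)"
  proof (rule openin_subopen[THEN iffD2], rule ballI)
    fix y assume "y \<in> classify ` S"
    then obtain A where A: "A \<in> S" "y = classify A" by blast
    then have "A \<in> model.coset ` carrier base.P" using openin_subset[OF S] unfolding model.topspace_T model.carrier_Q by blast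
    then obtain \<alpha> where \<alpha>: "\<alpha> \<in> carrier base.P" "A = model.coset \<alpha>" by blast
    have y: "y = lift_end \<alpha>" "y \<in> carrier K" using A \<alpha> by (simp_all add: classify_coset)
    obtain U where U: "openin X U" "\<one>\<^bsub>G\<^esub> \<in> U" "model.sheet U \<alpha> \<subseteq> S"
      using model.openin_T_sheetD[OF S \<alpha>(1)] A(1) \<alpha>(2) by blast
    obtain B where B: "openin Y B" "\<one>\<^bsub>K\<^esub> \<in> B" "B \<subseteq> lift_end ` base.small U"
      by (rule small_lift_ends_nbhd[OF U(1,2)])
    let ?C = "{z \<in> carrier K. z \<otimes>\<^bsub>K\<^esub> inv\<^bsub>K\<^esub> y \<in> B}"
    have "openin Y ?C" by (rule cover.open_mult_vimage[OF B(1)]) (use y in simp)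
    moreover have "y \<in> ?C" using y(2) B(2) by simp
    moreover have "?C \<subseteq> classify ` S"
    proof
      fix z assume z: "z \<in> ?C"
      then obtain \<beta> where \<beta>: "\<beta> \<in> base.small U" "z \<otimes>\<^bsub>K\<^esub> inv\<^bsub>K\<^esub> y = lift_end \<beta>" using B(3) by blast
      have \<beta>P: "\<beta> \<in> carrier base.P" using \<beta>(1) by (rule model.small_carrier)
      have "z = lift_end \<beta> \<otimes>\<^bsub>K\<^esub> y" using z y(2) by (simp add: \<beta>(2)[symmetric] cover.m_assoc)
      also have "\<dots> = classify (model.coset (\<beta> \<otimes>\<^bsub>base.P\<^esub> \<alpha>))"
        using classify_coset[of "\<beta> \<otimes>\<^bsub>base.P\<^esub> \<alpha>"] \<alpha>(1) \<beta>P y(1) by (simp del: model.coset.hom_mult)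
      finally have "z = classify (model.coset (\<beta> \<otimes>\<^bsub>base.P\<^esub> \<alpha>))" .
      moreover have "model.coset (\<beta> \<otimes>\<^bsub>base.P\<^esub> \<alpha>) \<in> S"
        using U(3) \<beta>(1) unfolding model.sheet_def by blast
      ultimately show "z \<in> classify ` S" by (rule image_eqI)
    qed
    ultimately show "\<exists>C. openin Y C \<and> y \<in> C \<and> C \<subseteq> classify ` S" by blast
  qed
qed

lemma equivalent_model: "covering_group_equivalent (model.Q, model.T, model.proj) (K, Y, p)"
proof -
  have "bij_betw classify (carrier model.Q) (carrier K)" using classify_iso unfolding iso_def by blast
  then have "homeomorphic_map model.T Y classify"
    by (intro bijective_open_imp_homeomorphic_map continuous_classify open_map_classify)
       (simp_all add: model.topspace_T bij_betw_def)
  moreover have "classify \<in> hom model.Q K" using classify_iso unfolding iso_def by blast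
  ultimately show ?thesis
    unfolding covering_group_equivalent_def prod.case using p_classify by blast
qed

text \<open>
  The image of a class is defined as a union over its members; as \<open>p\<close> carries homotopies to
  homotopies, all of them contribute the same class.
\<close>

lemma pi1_map_push:
  assumes \<gamma>: "\<gamma> \<in> cover.L"
  shows "pi1_map X \<one>\<^bsub>G\<^esub> p (cover.cls \<gamma>) = base.cls (push \<gamma>)"
proof -
  have "base.cls (push \<gamma>') = base.cls (push \<gamma>)" if \<gamma>': "\<gamma>' \<in> cover.cls \<gamma>" for \<gamma>'
  proof -
    have *: "\<gamma>' \<in> cover.L" "cover.cls \<gamma>' = cover.cls \<gamma>" using \<gamma>' \<gamma> by (simp_all add: cover.mem_cls_iff)
    then have "(\<gamma>', \<gamma>) \<in> loop_homotopy Y \<one>\<^bsub>K\<^esub>" using \<gamma> by (simp add: cover.cls_eq_iff)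
    then obtain h where h: "continuous_map (prod_topology unit_interval unit_interval) Y h"
      "\<And>s. s \<in> {0..1} \<Longrightarrow> h (s, 0) = \<one>\<^bsub>K\<^esub>" "\<And>s. s \<in> {0..1} \<Longrightarrow> h (s, 1) = \<one>\<^bsub>K\<^esub>"
      "cover.slice h 0 = \<gamma>'" "cover.slice h 1 = \<gamma>"
      by (rule cover.loop_homotopyE) blast
    show ?thesis
    proof (rule base.cls_eqI[OF continuous_map_compose[OF h(1) continuous_p]])
      show "(p \<circ> h) (0, t) = push \<gamma>' t" "(p \<circ> h) (1, t) = push \<gamma> t" if "t \<in> {0..1}" for t
        unfolding h(4,5)[symmetric] using that by (simp_all add: push_at cover.slice_def)
    qed (use h * \<gamma> push_loops in auto)
  qed
  moreover have "\<gamma> \<in> cover.cls \<gamma>" by (rule cover.cls_self[OF \<gamma>])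
  ultimately show ?thesis unfolding pi1_map_def push_def[symmetric] by blast
qed

lemma pi1_image_eq: "covering_group_pi1_image G X (K, Y, p) = base.cls ` closed_lifts"
  unfolding covering_group_pi1_image_def prod.case cover.pi1_carrier closed_lifts_def image_image
  by (rule image_cong) (simp_all add: pi1_map_push)

lemma pi1_image_open_subgroup:
  "covering_group_pi1_image G X (K, Y, p) \<in> open_subgroups_pi1 X \<one>\<^bsub>G\<^esub>"
proof -
  have sub: "subgroup (base.cls ` closed_lifts) base.pi1"
    by (rule base.subgroup_cls_image[OF subgroup_closed_lifts closed_lifts_subset])
  have "base.loops_of (base.cls ` closed_lifts) = closed_lifts"
    unfolding base.loops_of_def using closed_lifts_homotopy closed_lifts_subset by blast
  moreover obtain U W \<sigma> where s: "section_on U W \<sigma>" using ex_section by blast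
  moreover have "openin (loop_space X \<one>\<^bsub>G\<^esub>) closed_lifts"
    by (rule base.open_subgroup_of_loops[OF subgroup_closed_lifts closed_lifts_subset
          section_onD(1,2)[OF s] closed_lifts_small[OF s]])
  ultimately show ?thesis
    unfolding pi1_image_eq open_subgroups_pi1_def
    using sub subgroup.subset[OF sub] by (simp add: base.openin_qtop_iff)
qed

end

section \<open>The classification\<close>

context covering_group
begin

lemma loops_of_pi1_image: "base.loops_of (covering_group_pi1_image G X (K, Y, p)) = closed_lifts"
  unfolding pi1_image_eq base.loops_of_def using closed_lifts_homotopy closed_lifts_subset by blast

end

lemma covering_groupI:
  assumes "topological_group G X" "connected_space X" "locally_path_connected_space X"
    and "connected_covering_group G X (K, Y, p)"
  shows "covering_group G X K Y p"
  using assms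
  by (simp add: covering_group_def covering_group_axioms_def connected_covering_group_def top_group_iff)

context loop_covering
begin

lemma covering_group_model: "covering_group G X Q T proj"
  using connected_covering_group_Q top_group_axioms connected locally_path_connected
  by (intro covering_groupI) (simp_all add: top_group_iff)

text \<open>
  The construction recovers \<open>N\<close>: the lift of \<open>\<alpha>\<close> to \<open>P / N\<close> ends at the coset of \<open>\<alpha>\<close>, so it is closed
  exactly when \<open>\<alpha>\<close> belongs to \<open>N\<close>.
\<close>

lemma closed_lifts_model: "covering_group.closed_lifts Q T proj = N"
proof -
  interpret C: covering_group G X Q T proj by (rule covering_group_model)
  have lift: "\<exists>\<eta>\<in>carrier C.cover.P. C.push \<eta> = \<alpha> \<and> \<eta> 1 = coset \<alpha>" if \<alpha>: "\<alpha> \<in> carrier P" for \<alpha>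
  proof -
    obtain \<eta> where \<eta>: "\<eta> \<in> paths_from T \<one>\<^bsub>Q\<^esub>" "\<And>s. s \<in> {0..1} \<Longrightarrow> proj (\<eta> s) = \<alpha> s" "\<eta> 1 = coset \<alpha>"
      by (rule lift_to_cover[OF \<alpha>]) blast
    have P: "\<eta> \<in> carrier C.cover.P" using \<eta>(1) by (simp add: C.cover.path_group_simps)
    have "C.push \<eta> = \<alpha>"
      by (rule path_eqI[OF C.push_closed[OF P] \<alpha>]) (simp add: C.push_at \<eta>(2))
    then show ?thesis using P \<eta>(3) by blast
  qed
  have "\<alpha> \<in> C.closed_lifts \<longleftrightarrow> \<alpha> \<in> N" if \<alpha>: "\<alpha> \<in> carrier P" for \<alpha>
  proof -
    obtain \<eta> where \<eta>: "\<eta> \<in> carrier C.cover.P" "C.push \<eta> = \<alpha>" "\<eta> 1 = coset \<alpha>" using lift[OF \<alpha>] by blast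
    have "\<alpha> \<in> C.closed_lifts \<longleftrightarrow> coset \<alpha> = \<one>\<^bsub>Q\<^esub>"
      using C.cover_endpoint_in_loops_iff[OF \<eta>(1)] \<eta>(2,3) by simp
    also have "\<dots> \<longleftrightarrow> coset \<alpha> = coset \<one>\<^bsub>P\<^esub>" by simp
    also have "\<dots> \<longleftrightarrow> \<alpha> \<in> N" using coset_eq_iff[OF \<alpha> P.one_closed] \<alpha> by simp
    finally show ?thesis .
  qed
  then show ?thesis using C.closed_lifts_subset N_loops loops_subset by blast
qed

lemma pi1_image_model: "covering_group_pi1_image G X (Q, T, proj) = cls ` N"
  using covering_group.pi1_image_eq[OF covering_group_model] closed_lifts_model by simp

end

context top_group
begin

text \<open>
  Openness of \<open>H\<close> supplies the small loops; closure under homotopy and normality hold for the loops of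
  any subgroup.
\<close>

lemma loop_covering_loops_of:
  assumes "connected_space X" "locally_path_connected_space X" and H: "H \<in> open_subgroups_pi1 X \<one>"
  shows "loop_covering G X (loops_of H)"
proof (intro loop_covering.intro loop_covering_axioms.intro top_group_axioms assms(1,2))
  have sub: "subgroup H pi1" and op: "openin (loop_space X \<one>) (loops_of H)"
    using H by (auto simp: open_subgroups_pi1_def openin_qtop_iff)
  show "loops_of H \<lhd> P" by (rule normal_loops_of[OF sub])
  show "loops_of H \<subseteq> L" by (auto simp: loops_of_def)
  show "\<delta> \<in> loops_of H" if "\<gamma> \<in> loops_of H" "\<delta> \<in> L" "cls \<gamma> = cls \<delta>" for \<gamma> \<delta>
    using that by (simp add: loops_of_def)
  have "\<one>\<^bsub>P\<^esub> \<in> loops_of H" by (rule subgroup.one_closed[OF subgroup_loops_of[OF sub]])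
  then obtain U where "openin X U" "\<one> \<in> U" "L \<inter> small U \<subseteq> loops_of H"
    by (rule small_loops_in_open[OF op])
  then show "\<exists>U. openin X U \<and> \<one> \<in> U \<and> L \<inter> small U \<subseteq> loops_of H" by blast
qed

end

lemma covering_group_equivalent_trans:
  assumes "covering_group_equivalent C D" "covering_group_equivalent D E"
  shows "covering_group_equivalent C E"
proof -
  obtain K Y p L Z q M V r where CDE: "C = (K, Y, p)" "D = (L, Z, q)" "E = (M, V, r)"
    by (cases C, cases D, cases E)
  obtain \<phi> where \<phi>: "\<phi> \<in> hom K L" "homeomorphic_map Y Z \<phi>" "\<forall>x\<in>carrier K. q (\<phi> x) = p x"
    using assms(1) by (auto simp: CDE covering_group_equivalent_def)
  obtain \<psi> where \<psi>: "\<psi> \<in> hom L M" "homeomorphic_map Z V \<psi>" "\<forall>x\<in>carrier L. r (\<psi> x) = q x"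
    using assms(2) by (auto simp: CDE covering_group_equivalent_def)
  have "\<psi> \<circ> \<phi> \<in> hom K M" by (rule hom_compose[OF \<phi>(1) \<psi>(1)])
  moreover have "homeomorphic_map Y V (\<psi> \<circ> \<phi>)" by (rule homeomorphic_map_compose[OF \<phi>(2) \<psi>(2)])
  moreover have "r ((\<psi> \<circ> \<phi>) x) = p x" if "x \<in> carrier K" for x
    using \<phi>(3) \<psi>(3) hom_in_carrier[OF \<phi>(1) that] that by simp
  ultimately show ?thesis unfolding CDE covering_group_equivalent_def prod.case by blast
qed

lemma covering_group_equivalent_sym:
  assumes C: "connected_covering_group G X C" and D: "connected_covering_group G X D"
    and "covering_group_equivalent C D"
  shows "covering_group_equivalent D C"
proof -
  obtain K Y p L Z q where CD: "C = (K, Y, p)" "D = (L, Z, q)" by (cases C, cases D)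
  have gK: "group K" and top: "topspace Y = carrier K" "topspace Z = carrier L"
    using C D by (auto simp: CD connected_covering_group_def topological_group_def)
  obtain \<phi> where \<phi>: "\<phi> \<in> hom K L" "homeomorphic_map Y Z \<phi>" "\<forall>x\<in>carrier K. q (\<phi> x) = p x"
    using assms(3) by (auto simp: CD covering_group_equivalent_def)
  obtain \<psi> where "homeomorphic_maps Y Z \<phi> \<psi>" using \<phi>(2) homeomorphic_map_maps by blast
  then have \<psi>: "homeomorphic_map Z Y \<psi>" "\<And>x. x \<in> carrier K \<Longrightarrow> \<psi> (\<phi> x) = x" "\<And>y. y \<in> carrier L \<Longrightarrow> \<phi> (\<psi> y) = y"
    unfolding homeomorphic_maps_map top by blast+
  have \<psi>K: "\<psi> y \<in> carrier K" if "y \<in> carrier L" for y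
    using homeomorphic_imp_surjective_map[OF \<psi>(1)] that unfolding top by blast
  have "\<psi> \<in> hom L K"
  proof (rule homI[OF \<psi>K])
    fix x y assume xy: "x \<in> carrier L" "y \<in> carrier L"
    have "\<phi> (\<psi> x \<otimes>\<^bsub>K\<^esub> \<psi> y) = x \<otimes>\<^bsub>L\<^esub> y"
      using hom_mult[OF \<phi>(1) \<psi>K[OF xy(1)] \<psi>K[OF xy(2)]] \<psi>(3) xy by simp
    moreover have "\<psi> x \<otimes>\<^bsub>K\<^esub> \<psi> y \<in> carrier K"
      using \<psi>K xy by (intro monoid.m_closed group.is_monoid gK)
    ultimately show "\<psi> (x \<otimes>\<^bsub>L\<^esub> y) = \<psi> x \<otimes>\<^bsub>K\<^esub> \<psi> y" using \<psi>(2) by metis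
  qed
  moreover have "p (\<psi> y) = q y" if "y \<in> carrier L" for y
    using \<phi>(3) \<psi>K[OF that] \<psi>(3)[OF that] by metis
  ultimately show ?thesis using \<psi>(1) unfolding CD covering_group_equivalent_def prod.case by blast
qed

lemma closed_lifts_mono:
  assumes "covering_group G X K Y p" "covering_group G X L Z q"
    and "covering_group_equivalent (K, Y, p) (L, Z, q)"
  shows "covering_group.closed_lifts K Y p \<subseteq> covering_group.closed_lifts L Z q"
proof -
  interpret C: covering_group G X K Y p by fact
  interpret D: covering_group G X L Z q by fact
  obtain \<phi> where \<phi>: "\<phi> \<in> hom K L" "homeomorphic_map Y Z \<phi>" "\<forall>x\<in>carrier K. q (\<phi> x) = p x"
    using assms(3) by (auto simp: covering_group_equivalent_def)
  have one: "\<phi> \<one>\<^bsub>K\<^esub> = \<one>\<^bsub>L\<^esub>" by (rule hom_one[OF \<phi>(1) C.cover.group_axioms D.cover.group_axioms])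
  show ?thesis
  proof
    fix \<alpha> assume "\<alpha> \<in> C.closed_lifts"
    then obtain \<gamma> where \<gamma>: "\<gamma> \<in> C.cover.L" "\<alpha> = C.push \<gamma>" unfolding C.closed_lifts_def by blast
    then have \<gamma>P: "\<gamma> \<in> carrier C.cover.P" using C.cover.loops_subset by blast
    let ?\<delta> = "restrict (\<phi> \<circ> \<gamma>) {0..1}"
    have "continuous_map unit_interval Z (\<phi> \<circ> \<gamma>)"
      by (rule continuous_map_compose[OF C.cover.path_continuous[OF \<gamma>P] homeomorphic_imp_continuous_map[OF \<phi>(2)]])
    then have \<delta>P: "?\<delta> \<in> carrier D.cover.P"
      by (rule D.cover.restrict_in_path_group) (simp add: C.cover.path_at_0[OF \<gamma>P] one)
    then have "?\<delta> \<in> D.cover.L" using \<gamma>(1) by (simp add: D.cover.loops_iff_end C.cover.loops_iff_end one)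
    moreover have "D.push ?\<delta> = \<alpha>"
    proof (rule C.base.path_eqI[OF D.push_closed[OF \<delta>P]])
      show "\<alpha> \<in> carrier C.base.P" unfolding \<gamma>(2) by (rule C.push_closed[OF \<gamma>P])
      fix t :: real assume t: "t \<in> {0..1}"
      then show "D.push ?\<delta> t = \<alpha> t"
        unfolding \<gamma>(2) using \<phi>(3) C.cover.path_in_carrier[OF \<gamma>P t] by (simp add: C.push_at D.push_at)
    qed
    ultimately show "\<alpha> \<in> D.closed_lifts" unfolding D.closed_lifts_def by blast
  qed
qed

text \<open>
  Both covering groups are equivalent to the model built from their loops with closed lift, and these
  loops can be recovered from the image of the fundamental group.
\<close>

lemma equivalent_iff_pi1_image_eq:
  assumes G: "topological_group G X" "connected_space X" "locally_path_connected_space X"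
    and C: "connected_covering_group G X C" and D: "connected_covering_group G X D"
  shows "covering_group_equivalent C D \<longleftrightarrow> covering_group_pi1_image G X C = covering_group_pi1_image G X D"
proof -
  obtain K Y p L Z q where CD: "C = (K, Y, p)" "D = (L, Z, q)" by (cases C, cases D)
  interpret C: covering_group G X K Y p using covering_groupI[OF G] C CD by simp
  interpret D: covering_group G X L Z q using covering_groupI[OF G] D CD by simp
  show ?thesis
  proof
    assume eq: "covering_group_equivalent C D"
    then have "covering_group_equivalent D C" by (rule covering_group_equivalent_sym[OF C D])
    with eq have "C.closed_lifts = D.closed_lifts"
      using closed_lifts_mono[OF C.covering_group_axioms D.covering_group_axioms]
        closed_lifts_mono[OF D.covering_group_axioms C.covering_group_axioms] unfolding CD by blast
    then show "covering_group_pi1_image G X C = covering_group_pi1_image G X D"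
      unfolding CD C.pi1_image_eq D.pi1_image_eq by simp
  next
    assume "covering_group_pi1_image G X C = covering_group_pi1_image G X D"
    then have eq: "C.closed_lifts = D.closed_lifts"
      unfolding CD using C.loops_of_pi1_image D.loops_of_pi1_image by metis
    have "covering_group_equivalent (C.model.Q, C.model.T, C.model.proj) C"
      unfolding CD by (rule C.equivalent_model)
    then have "covering_group_equivalent C (C.model.Q, C.model.T, C.model.proj)"
      by (rule covering_group_equivalent_sym[OF C.model.connected_covering_group_Q C])
    moreover have "covering_group_equivalent (C.model.Q, C.model.T, C.model.proj) D"
      using D.equivalent_model unfolding CD eq .
    ultimately show "covering_group_equivalent C D" by (rule covering_group_equivalent_trans)
  qed
qed

theorem corollary3p8:
  fixes G :: "'a monoid" and X :: "'a topology"
  assumes "topological_group G X"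
    and "connected_space X"
    and "locally_path_connected_space X"
  shows "(\<exists>\<Phi>.
           bij_betw \<Phi>
             ((connected_covering_groups G X :: 'a path_group_over set) // covering_group_equiv_rel G X)
             (open_subgroups_pi1 X \<one>\<^bsub>G\<^esub>) \<and>
           (\<forall>C \<in> (connected_covering_groups G X :: 'a path_group_over set).
              \<Phi> (covering_group_equiv_rel G X `` {C}) = covering_group_pi1_image G X C)) \<and>
         (\<forall>C :: ('h, 'a) group_over. connected_covering_group G X C \<longrightarrow>
            (\<exists>D :: 'a path_group_over.
               connected_covering_group G X D \<and> covering_group_equivalent C D))"
proof (intro conjI allI impI)
  interpret top_group G X using assms(1) by (simp add: top_group_iff)
  let ?CG = "connected_covering_groups G X :: 'a path_group_over set"
  let ?R = "covering_group_equiv_rel G X :: ('a path_group_over \<times> 'a path_group_over) set"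
  let ?im = "covering_group_pi1_image G X :: 'a path_group_over \<Rightarrow> _"
  have rel: "(C, D) \<in> ?R \<longleftrightarrow> C \<in> ?CG \<and> D \<in> ?CG \<and> ?im C = ?im D" for C D
    using equivalent_iff_pi1_image_eq[OF assms, of C D]
    by (auto simp: covering_group_equiv_rel_def connected_covering_groups_def)
  have equiv: "equiv ?CG ?R"
    by (intro equivI refl_onI symI transI) (auto simp: rel)
  \<comment> \<open>The image is constant on equivalence classes, so its set of values on a class is a singleton.\<close>
  let ?\<Phi> = "\<lambda>S. the_elem (?im ` S)"
  have \<Phi>: "?\<Phi> (?R `` {C}) = ?im C" if "C \<in> ?CG" for C
  proof -
    have "?im ` (?R `` {C}) = {?im C}" using that by (auto simp: rel)
    then show ?thesis by simp
  qed
  have "bij_betw ?\<Phi> (?CG // ?R) (open_subgroups_pi1 X \<one>\<^bsub>G\<^esub>)"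
    unfolding bij_betw_def
  proof (intro conjI)
    show "inj_on ?\<Phi> (?CG // ?R)"
    proof (rule inj_onI)
      fix S S' assume S: "S \<in> ?CG // ?R" "S' \<in> ?CG // ?R" "?\<Phi> S = ?\<Phi> S'"
      obtain C D where C: "C \<in> ?CG" "S = ?R `` {C}" and D: "D \<in> ?CG" "S' = ?R `` {D}"
        using S(1,2) by (elim quotientE) blast
      then have "(C, D) \<in> ?R" using S(3) \<Phi> rel by simp
      then show "S = S'" unfolding C(2) D(2) by (rule equiv_class_eq[OF equiv])
    qed
    have "H \<in> open_subgroups_pi1 X \<one>\<^bsub>G\<^esub>" if H: "H \<in> ?\<Phi> ` (?CG // ?R)" for H
    proof -
      obtain C where C: "C \<in> ?CG" "H = ?im C" using H \<Phi> by (auto elim!: quotientE)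
      obtain K Y p where "C = (K, Y, p)" by (cases C)
      then show ?thesis
        using C covering_group.pi1_image_open_subgroup[OF covering_groupI[OF assms]]
        by (simp add: connected_covering_groups_def)
    qed
    moreover have "H \<in> ?\<Phi> ` (?CG // ?R)" if H: "H \<in> open_subgroups_pi1 X \<one>\<^bsub>G\<^esub>" for H
    proof -
      interpret M: loop_covering G X "loops_of H" by (rule loop_covering_loops_of[OF assms(2,3) H])
      have "H \<subseteq> carrier pi1" using H by (auto simp: open_subgroups_pi1_def dest: subgroup.subset)
      then have "?im (M.Q, M.T, M.proj) = H" unfolding M.pi1_image_model by (rule image_loops_of)
      moreover have M: "(M.Q, M.T, M.proj) \<in> ?CG"
        using M.connected_covering_group_Q by (simp add: connected_covering_groups_def)
      ultimately have "H = ?\<Phi> (?R `` {(M.Q, M.T, M.proj)})" unfolding \<Phi>[OF M] by (simp only:)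
      then show ?thesis by (rule image_eqI[OF _ quotientI[OF M]])
    qed
    ultimately show "?\<Phi> ` (?CG // ?R) = open_subgroups_pi1 X \<one>\<^bsub>G\<^esub>" by blast
  qed
  then show "\<exists>\<Phi>. bij_betw \<Phi> (?CG // ?R) (open_subgroups_pi1 X \<one>\<^bsub>G\<^esub>) \<and> (\<forall>C\<in>?CG. \<Phi> (?R `` {C}) = ?im C)"
    by (intro exI[of _ ?\<Phi>] conjI ballI \<Phi>)
next
  fix C :: "('h, 'a) group_over"
  assume C: "connected_covering_group G X C"
  obtain K Y p where K: "C = (K, Y, p)" by (cases C)
  interpret C: covering_group G X K Y p using covering_groupI[OF assms] C K by simp
  have "covering_group_equivalent (C.model.Q, C.model.T, C.model.proj) C"
    unfolding K by (rule C.equivalent_model)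
  then have "covering_group_equivalent C (C.model.Q, C.model.T, C.model.proj)"
    by (rule covering_group_equivalent_sym[OF C.model.connected_covering_group_Q C])
  then show "\<exists>D :: 'a path_group_over. connected_covering_group G X D \<and> covering_group_equivalent C D"
    using C.model.connected_covering_group_Q by blast
qed

end
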